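(* Suppose that the conformal mapping $\sigma$ has a continuous contour derivative $\sigma'(T)$ on the unit circle $\Gamma$ with $\sigma'(T)\neq 0$ for all $T\in\Gamma$, and that $$\int_{0}^{1}\frac{\omega_{\Gamma}(\sigma',\eta)}{\eta}\,d\eta<\infty .$$ Let $k(t,s)=k_1(t,s)e_1+i\rho\,k_2(t,s)$. Then the operator $$\mathcal{I}[g](t):=\int_{-\infty}^{\infty}g(s)\,k(t,s)\,ds$$ is compact in the space $C(\overline{\mathbb{R}};\mathbb{B})$ of continuous functions $g:\overline{\mathbb{R}}\to\mathbb{B}$ with the supremum norm (the value of $\mathcal{I}[g]$ at $t=\infty$ being the limit of $\mathcal{I}[g](t)$ as $t\in\mathbb{R}$, $|t|\to\infty$).
   Context: $\mathbb{B}$ is the commutative associative two-dimensional algebra over $\mathbb{C}$ with basis $\{e_1,e_2\}$ and multiplication $e_1^2=e_1$, $e_2e_1=e_2$, $e_2^2=e_1+2ie_2$ (so $e_1$ is the unit), with norm $\|z_1e_1+z_2e_2\|=\sqrt{|z_1|^2+|z_2|^2}$. Put $\rho:=2e_1+2ie_2$ (so $\rho^2=0$). $D$ is a bounded domain in $\mathbb{R}^2$ whose boundary $\partial D$ is a closed smooth Jordan curve, and $D_z:=\{x+iy\in\mathbb{C}:(x,y)\in D\}$. $\sigma$ is a conformal mapping of the unit disk $\{|T|<1\}$ onto $D_z$, extended to a homeomorphism of the closures, and $\tau(t):=\sigma\left(\frac{t-i}{t+i}\right)$ is the corresponding conformal mapping of the upper half-plane onto $D_z$, also considered on $\overline{\mathbb{R}}:=\mathbb{R}\cup\{\infty\}$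 (the one-point compactification, with $t=\infty$ corresponding to $T=1$). Write $\tau_1=\mathrm{Re}\,\tau$, $\tau_2=\mathrm{Im}\,\tau$. $\Gamma:=\{T\in\mathbb{C}:|T|=1\}$. The contour derivative on $\Gamma$ is $\sigma'(T)=\lim_{S\to T,\,S\in\Gamma}\frac{\sigma(S)-\sigma(T)}{S-T}$. For continuous $\varphi:\Gamma\to\mathbb{C}$, $\omega_\Gamma(\varphi,\varepsilon):=\sup\{|\varphi(t_1)-\varphi(t_2)|: t_1,t_2\in\Gamma,\ |t_1-t_2|\le\varepsilon\}$. For $t,s\in\mathbb{R}$, $s\ne t$ (primes denote derivatives in $s$ along $\mathbb{R}$): $$k_1(t,s):=\frac{\tau'(s)}{\tau(s)-\tau(t)}-\frac{1+st}{(s-t)(s^2+1)},$$ $$k_2(t,s):=\frac{\tau'(s)\bigl(\tau_2(s)-\tau_2(t)\bigr)}{2\bigl(\tau(s)-\tau(t)\bigr)^2}-\frac{\tau_2'(s)}{2\bigl(\tau(s)-\tau(t)\bigr)}.$$ *)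

theory Defs
  imports "HOL-Analysis.Analysis"
begin

section \<open>The biharmonic algebra\<close>

text \<open>\<open>Biharm z1 z2\<close> stands for \<open>z1 e1 + z2 e2\<close>.\<close>

datatype biharm = Biharm (coord1: complex) (coord2: complex)

lemma biharm_eq_iff: "x = y \<longleftrightarrow> coord1 x = coord1 y \<and> coord2 x = coord2 y"
  by (cases x; cases y) simp

instantiation biharm :: comm_ring_1
begin

definition "0 = Biharm 0 0"
definition "1 = Biharm 1 0"
definition "x + y = Biharm (coord1 x + coord1 y) (coord2 x + coord2 y)"
definition "- x = Biharm (- coord1 x) (- coord2 x)"
definition "x - y = Biharm (coord1 x - coord1 y) (coord2 x - coord2 y)"

text \<open>The bilinear extension of \<open>e1 * e1 = e1\<close>, \<open>e1 * e2 = e2\<close>, \<open>e2 * e2 = e1 + 2 \<i> e2\<close>.\<close>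

definition "x * y =
  Biharm (coord1 x * coord1 y + coord2 x * coord2 y)
         (coord1 x * coord2 y + coord2 x * coord1 y + 2 * \<i> * coord2 x * coord2 y)"

instance
  by standard
    (auto simp: zero_biharm_def one_biharm_def plus_biharm_def uminus_biharm_def
       minus_biharm_def times_biharm_def algebra_simps)

end

lemma biharm_coord_simps [simp]:
  "coord1 0 = 0" "coord2 0 = 0" "coord1 1 = 1" "coord2 1 = 0"
  "coord1 (x + y) = coord1 x + coord1 y" "coord2 (x + y) = coord2 x + coord2 y"
  "coord1 (- x) = - coord1 x" "coord2 (- x) = - coord2 x"
  "coord1 (x - y) = coord1 x - coord1 y" "coord2 (x - y) = coord2 x - coord2 y"
  "coord1 (x * y) = coord1 x * coord1 y + coord2 x * coord2 y"
  "coord2 (x * y) = coord1 x * coord2 y + coord2 x * coord1 y + 2 * \<i> * coord2 x * coord2 y"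
  by (simp_all add: zero_biharm_def one_biharm_def plus_biharm_def uminus_biharm_def
       minus_biharm_def times_biharm_def)

definition scaleC :: "complex \<Rightarrow> biharm \<Rightarrow> biharm"  (infixr \<open>*\<^sub>\<complex>\<close> 75)
  where "c *\<^sub>\<complex> x = Biharm (c * coord1 x) (c * coord2 x)"

definition e1 :: biharm where "e1 = Biharm 1 0"
definition e2 :: biharm where "e2 = Biharm 0 1"

lemma biharm_expansion: "x = coord1 x *\<^sub>\<complex> e1 + coord2 x *\<^sub>\<complex> e2"
  by (simp add: biharm_eq_iff scaleC_def e1_def e2_def)

lemma biharm_multiplication_table:
  "e1 * e1 = e1" "e2 * e1 = e2" "e2 * e2 = e1 + (2 * \<i>) *\<^sub>\<complex> e2"
  by (simp_all add: biharm_eq_iff scaleC_def e1_def e2_def)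

lemma scaleC_mult: "(c *\<^sub>\<complex> x) * y = c *\<^sub>\<complex> (x * y)" "x * (c *\<^sub>\<complex> y) = c *\<^sub>\<complex> (x * y)"
  by (simp_all add: biharm_eq_iff scaleC_def algebra_simps)

definition rho :: biharm where "rho = 2 *\<^sub>\<complex> e1 + (2 * \<i>) *\<^sub>\<complex> e2"

lemma rho_square: "rho * rho = 0"
  by (simp add: biharm_eq_iff scaleC_def e1_def e2_def rho_def)

text \<open>The prescribed norm is the Euclidean one.  It is not submultiplicative
  (\<open>e2 * e2\<close> has norm \<open>sqrt 5\<close>), so there is no \<^class>\<open>real_normed_algebra\<close> instance.\<close>

instantiation biharm :: real_algebra_1
begin

definition "r *\<^sub>R x = Biharm (r *\<^sub>R coord1 x) (r *\<^sub>R coord2 x)" for r :: real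

instance
  by standard (auto simp: biharm_eq_iff scaleR_biharm_def algebra_simps)

end

lemma coord_scaleR [simp]: "coord1 (r *\<^sub>R x) = r *\<^sub>R coord1 x" "coord2 (r *\<^sub>R x) = r *\<^sub>R coord2 x"
  by (simp_all add: scaleR_biharm_def)

instantiation biharm :: real_inner
begin

definition norm_biharm :: "biharm \<Rightarrow> real"
  where "norm x = sqrt ((cmod (coord1 x))\<^sup>2 + (cmod (coord2 x))\<^sup>2)"

definition inner_biharm :: "biharm \<Rightarrow> biharm \<Rightarrow> real"
  where "inner x y = inner (coord1 x) (coord1 y) + inner (coord2 x) (coord2 y)"

definition sgn_biharm :: "biharm \<Rightarrow> biharm"
  where "sgn x = x /\<^sub>R norm x" for x :: biharm

definition dist_biharm :: "biharm \<Rightarrow> biharm \<Rightarrow> real"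
  where "dist x y = norm (x - y)" for x y :: biharm

definition uniformity_biharm :: "(biharm \<times> biharm) filter"
  where "uniformity = (INF e\<in>{0 <..}. principal {(x :: biharm, y). dist x y < e})"

definition open_biharm :: "biharm set \<Rightarrow> bool"
  where "open U \<longleftrightarrow> (\<forall>x\<in>U. eventually (\<lambda>(x', y). x' = x \<longrightarrow> y \<in> U) uniformity)"
    for U :: "biharm set"

instance
proof
  fix x y z :: biharm and r :: real
  show "inner x y = inner y x"
    by (simp add: inner_biharm_def inner_commute)
  show "inner (x + y) z = inner x z + inner y z"
    by (simp add: inner_biharm_def inner_add_left)
  show "inner (r *\<^sub>R x) y = r * inner x y"
    unfolding inner_biharm_def coord_scaleR inner_scaleR_left by (simp add: distrib_left)
  show "0 \<le> inner x x"
    by (simp add: inner_biharm_def)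
  show "inner x x = 0 \<longleftrightarrow> x = 0"
    by (simp add: inner_biharm_def add_nonneg_eq_0_iff biharm_eq_iff)
  show "norm x = sqrt (inner x x)"
    by (simp add: inner_biharm_def norm_biharm_def power2_norm_eq_inner)
  show "dist x y = norm (x - y)"
    by (rule dist_biharm_def)
  show "sgn x = x /\<^sub>R norm x"
    by (rule sgn_biharm_def)
  show "(uniformity :: (biharm \<times> biharm) filter) = (INF e\<in>{0 <..}. principal {(x, y). dist x y < e})"
    by (rule uniformity_biharm_def)
  show "open U \<longleftrightarrow> (\<forall>x\<in>U. eventually (\<lambda>(x', y). x' = x \<longrightarrow> y \<in> U) uniformity)" for U :: "biharm set"
    by (rule open_biharm_def)
qed

end

text \<open>This instance makes \<^typ>\<open>biharm\<close> a separable Banach space, as needed for Bochner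
  integrals of \<^typ>\<open>biharm\<close>-valued functions.\<close>

instantiation biharm :: euclidean_space
begin

definition "Basis = {Biharm 1 0, Biharm \<i> 0, Biharm 0 1, Biharm 0 \<i>}"

instance
proof
  fix x :: biharm
  show "(\<forall>u\<in>Basis. inner x u = 0) \<longleftrightarrow> x = 0"
    by (cases x) (auto simp: Basis_biharm_def inner_biharm_def zero_biharm_def complex_eq_iff
        inner_complex_def)
qed (auto simp: Basis_biharm_def inner_biharm_def inner_complex_def)

end


section \<open>The one-point compactification of the real line\<close>

datatype rbar = Fin real | Infty

text \<open>Neighbourhoods of \<^term>\<open>Infty\<close> are the complements of compact sets of reals.\<close>

instantiation rbar :: topological_space
begin

definition open_rbar :: "rbar set \<Rightarrow> bool"
  where "open U \<longleftrightarrow> open (Fin -` U) \<and> (Infty \<in> U \<longrightarrow> compact (- (Fin -` U)))"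
    for U :: "rbar set"

instance
proof
  show "open (UNIV :: rbar set)"
    by (simp add: open_rbar_def)
  show "open (S \<inter> T)" if "open S" "open T" for S T :: "rbar set"
    using that by (auto simp: open_rbar_def vimage_Int Compl_Int intro!: compact_Un)
  show "open (\<Union>K)" if *: "\<forall>S\<in>K. open S" for K :: "rbar set set"
    unfolding open_rbar_def
  proof (intro conjI impI)
    show o: "open (Fin -` \<Union>K)"
      using * by (auto simp: open_rbar_def vimage_Union)
    assume "Infty \<in> \<Union>K"
    then obtain S where S: "S \<in> K" "Infty \<in> S" by blast
    then have "compact (- (Fin -` S))"
      using * by (auto simp: open_rbar_def)
    moreover have "- (Fin -` \<Union>K) = - (Fin -` S) \<inter> - (Fin -` \<Union>K)"
      using S by auto
    moreover have "closed (- (Fin -` \<Union>K))"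
      using o by (rule closed_Compl)
    ultimately show "compact (- (Fin -` \<Union>K))"
      by (metis compact_Int_closed)
  qed
qed

end

lemma compact_UNIV_rbar: "compact (UNIV :: rbar set)"
proof (rule compactI)
  fix C :: "rbar set set"
  assume C: "\<forall>t\<in>C. open t" "UNIV \<subseteq> \<Union>C"
  then obtain S where S: "S \<in> C" "Infty \<in> S" by blast
  then have "compact (- (Fin -` S))"
    using C by (auto simp: open_rbar_def)
  moreover have "- (Fin -` S) \<subseteq> \<Union> ((\<lambda>T. Fin -` T) ` C)"
    using C(2) by (auto simp: subset_eq)
  moreover have "open T" if "T \<in> (\<lambda>T. Fin -` T) ` C" for T
    using that C by (auto simp: open_rbar_def)
  ultimately obtain F where F: "F \<subseteq> (\<lambda>T. Fin -` T) ` C" "finite F" "- (Fin -` S) \<subseteq> \<Union>F"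
    by (metis (no_types, lifting) compactE)
  then obtain G where G: "G \<subseteq> C" "finite G" "F = (\<lambda>T. Fin -` T) ` G"
    by (meson finite_subset_image)
  have "x \<in> \<Union> (insert S G)" for x
    using S F(3) G(3) by (cases x) auto
  then show "\<exists>C'\<subseteq>C. finite C' \<and> UNIV \<subseteq> \<Union>C'"
    using S G by (intro exI[of _ "insert S G"]) auto
qed

text \<open>Hence the type \<open>rbar \<Rightarrow>\<^sub>C biharm\<close> of bounded continuous functions, whose norm is the
  supremum norm, is the space of all continuous functions.\<close>

lemma bcontfun_rbar_iff: "f \<in> bcontfun \<longleftrightarrow> continuous_on UNIV f"
  for f :: "rbar \<Rightarrow> 'b::metric_space"
  by (auto simp: bcontfun_def intro: compact_imp_bounded compact_continuous_image compact_UNIV_rbar)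


section \<open>Compact operators\<close>

definition compact_operator :: "('a::real_normed_vector \<Rightarrow> 'b::real_normed_vector) \<Rightarrow> bool"
  where "compact_operator T \<longleftrightarrow> linear T \<and> (\<forall>S. bounded S \<longrightarrow> compact (closure (T ` S)))"


section \<open>The domain, the conformal mapping and the kernel\<close>

text \<open>Closed Jordan curves with a \<open>C\<^sup>1\<close> regular parametrization, including at the point
  where the parametrization closes up.\<close>

definition smooth_jordan_curve :: "'a::real_normed_vector set \<Rightarrow> bool"
  where "smooth_jordan_curve C \<longleftrightarrow>
    (\<exists>\<gamma> \<gamma>'. simple_path \<gamma> \<and> pathfinish \<gamma> = pathstart \<gamma> \<and> path_image \<gamma> = C \<and>
      (\<forall>t\<in>{0..1}. (\<gamma> has_vector_derivative \<gamma>' t) (at t within {0..1}) \<and> \<gamma>' t \<noteq> 0) \<and>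
      continuous_on {0..1} \<gamma>' \<and> \<gamma>' 0 = \<gamma>' 1)"

definition complex_region :: "(real \<times> real) set \<Rightarrow> complex set"
  where "complex_region D = {Complex x y |x y. (x, y) \<in> D}"

definition conformal_disk_map :: "(complex \<Rightarrow> complex) \<Rightarrow> complex set \<Rightarrow> bool"
  where "conformal_disk_map \<sigma> R \<longleftrightarrow>
    \<sigma> holomorphic_on ball 0 1 \<and> bij_betw \<sigma> (ball 0 1) R \<and>
    (\<exists>\<sigma>inv. homeomorphism (cball 0 1) (closure R) \<sigma> \<sigma>inv)"

text \<open>\<open>\<sigma>'\<close> is the derivative of \<open>\<sigma>\<close> along the unit circle only: the limit of difference
  quotients is taken within the circle.\<close>

definition contour_derivative :: "(complex \<Rightarrow> complex) \<Rightarrow> (complex \<Rightarrow> complex) \<Rightarrow> bool"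
  where "contour_derivative \<sigma> \<sigma>' \<longleftrightarrow>
    (\<forall>T\<in>sphere 0 1. ((\<lambda>S. (\<sigma> S - \<sigma> T) / (S - T)) \<longlongrightarrow> \<sigma>' T) (at T within sphere 0 1))"

definition circle_modulus :: "(complex \<Rightarrow> complex) \<Rightarrow> real \<Rightarrow> real"
  where "circle_modulus \<phi> \<epsilon> =
    Sup {cmod (\<phi> t1 - \<phi> t2) |t1 t2. t1 \<in> sphere 0 1 \<and> t2 \<in> sphere 0 1 \<and> cmod (t1 - t2) \<le> \<epsilon>}"

text \<open>Only the values of \<open>\<tau>\<close> on the real line enter the kernel.\<close>

definition tau :: "(complex \<Rightarrow> complex) \<Rightarrow> real \<Rightarrow> complex"
  where "tau \<sigma> t = \<sigma> ((of_real t - \<i>) / (of_real t + \<i>))"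

definition tau2 :: "(complex \<Rightarrow> complex) \<Rightarrow> real \<Rightarrow> real"
  where "tau2 \<sigma> t = Im (tau \<sigma> t)"

abbreviation dtau :: "(complex \<Rightarrow> complex) \<Rightarrow> real \<Rightarrow> complex"
  where "dtau \<sigma> s \<equiv> vector_derivative (tau \<sigma>) (at s)"

abbreviation dtau2 :: "(complex \<Rightarrow> complex) \<Rightarrow> real \<Rightarrow> real"
  where "dtau2 \<sigma> s \<equiv> deriv (tau2 \<sigma>) s"

definition k1 :: "(complex \<Rightarrow> complex) \<Rightarrow> real \<Rightarrow> real \<Rightarrow> complex"
  where "k1 \<sigma> t s =
    dtau \<sigma> s / (tau \<sigma> s - tau \<sigma> t) - of_real ((1 + s * t) / ((s - t) * (s\<^sup>2 + 1)))"

definition k2 :: "(complex \<Rightarrow> complex) \<Rightarrow> real \<Rightarrow> real \<Rightarrow> complex"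
  where "k2 \<sigma> t s =
    dtau \<sigma> s * of_real (tau2 \<sigma> s - tau2 \<sigma> t) / (2 * (tau \<sigma> s - tau \<sigma> t)\<^sup>2)
    - of_real (dtau2 \<sigma> s) / (2 * (tau \<sigma> s - tau \<sigma> t))"

definition biharm_kernel :: "(complex \<Rightarrow> complex) \<Rightarrow> real \<Rightarrow> real \<Rightarrow> biharm"
  where "biharm_kernel \<sigma> t s = k1 \<sigma> t s *\<^sub>\<complex> e1 + (\<i> * k2 \<sigma> t s) *\<^sub>\<complex> rho"

definition integral_op_real :: "(complex \<Rightarrow> complex) \<Rightarrow> (rbar \<Rightarrow> biharm) \<Rightarrow> real \<Rightarrow> biharm"
  where "integral_op_real \<sigma> g t = (\<integral>s. g (Fin s) * biharm_kernel \<sigma> t s \<partial>lborel)"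

fun integral_op :: "(complex \<Rightarrow> complex) \<Rightarrow> (rbar \<Rightarrow> biharm) \<Rightarrow> rbar \<Rightarrow> biharm"
  where
    "integral_op \<sigma> g (Fin t) = integral_op_real \<sigma> g t"
  | "integral_op \<sigma> g Infty = Lim at_infinity (integral_op_real \<sigma> g)"

end

theory Submission
  imports Defs "HOL-Complex_Analysis.Great_Picard"
begin

text \<open>Substituting \<open>s = tan a\<close>, \<open>t = tan b\<close> gives \<open>\<tau>(s) = f(a)\<close> with the \<open>\<pi>\<close>-periodic curve
  \<open>f(a) = \<sigma>(-exp(2 i a))\<close>, and \<open>t = \<infinity>\<close> becomes \<open>b = \<plusminus>\<pi>/2\<close>.  Up to the Jacobian \<open>1 / (1 + s\<^sup>2)\<close>,
  \<open>k1\<close> becomes \<open>K1(b, a) = f'(a) / (f(a) - f(b)) - cot (a - b)\<close>, and since \<open>cot\<close> is real,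
  \<open>k2 = -Im k1 \<cdot> cnj \<Delta> / (2 \<Delta>)\<close> with \<open>\<Delta> = f(a) - f(b)\<close>, so that \<open>|k2| \<le> |k1| / 2\<close>.
  The curve satisfies \<open>|\<Delta>| \<ge> c |a - b|\<close> for \<open>|a - b| \<le> \<pi>/2\<close>, whence \<open>K1\<close> is bounded by
  \<open>C + C \<omega>(|a - b|) / |a - b|\<close>, which is integrable by the Dini condition.  It follows that
  \<open>b \<mapsto> K(b, \<cdot>)\<close> is continuous into \<open>L\<^sup>1\<close>; therefore the images of bounded sets are bounded and
  equicontinuous, and the theorem of Arzela and Ascoli applies.\<close>

section \<open>Operators with \<open>L\<^sup>1\<close>-continuous kernels\<close>

lemma norm_coord_le: "norm (coord1 x) \<le> norm x" "norm (coord2 x) \<le> norm x"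
  by (auto simp: norm_biharm_def intro: real_le_rsqrt)

lemma norm_biharm_le: "norm x \<le> norm (coord1 x) + norm (coord2 x)"
  unfolding norm_biharm_def by (rule sqrt_sum_squares_le_sum) auto

text \<open>Every product of a coordinate of x with one of y is at most
  \<open>norm x * norm y\<close>. The first coordinate of \<open>x * y\<close> contains two of
  these, the second two more and one with the factor 2i, hence 2 + 4 = 6.\<close>

lemma norm_biharm_mult_le: "norm (x * y) \<le> 6 * norm x * norm y" for x y :: biharm
proof -
  have le: "norm (u * v) \<le> norm x * norm y" if "norm u \<le> norm x" "norm v \<le> norm y" for u v :: complex
    using that by (simp add: norm_mult mult_mono)
  note [intro] = norm_coord_le
  have 1: "norm (coord1 (x * y)) \<le> 2 * (norm x * norm y)"
    by (auto intro!: order_trans[OF norm_triangle_ineq] order_trans[OF add_mono[OF le le]])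
  have c: "norm (coord1 x * coord2 y) \<le> norm x * norm y" "norm (coord2 x * coord1 y) \<le> norm x * norm y"
    "norm (coord2 x * coord2 y) \<le> norm x * norm y"
    by (auto intro!: le)
  have "norm (coord2 (x * y)) \<le> norm (coord1 x * coord2 y) + norm (coord2 x * coord1 y)
      + norm (2 * \<i> * (coord2 x * coord2 y))"
    by (simp only: biharm_coord_simps mult.assoc) (intro order_trans[OF norm_triangle_ineq] add_mono order_refl norm_triangle_ineq)
  also have "norm (2 * \<i> * (coord2 x * coord2 y)) = 2 * norm (coord2 x * coord2 y)"
    by (simp add: norm_mult)
  finally have "norm (coord2 (x * y)) \<le> 4 * (norm x * norm y)"
    using c by linarith
  with 1 norm_biharm_le[of "x * y"] show ?thesis by simp
qed

lemma bounded_bilinear_biharm_mult: "bounded_bilinear ((*) :: biharm \<Rightarrow> biharm \<Rightarrow> biharm)"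
  by standard (auto simp: algebra_simps intro!: exI[of _ 6] order_trans[OF norm_biharm_mult_le])

section \<open>Continuity on the compactified line and relative compactness\<close>

lemma continuous_on_Fin: "continuous_on UNIV Fin"
  by (simp add: continuous_on_open_vimage open_rbar_def)

text \<open>The limit confines the real points outside the preimage of a neighbourhood of
  \<open>h Infty\<close> to a bounded set; being closed as well, this set is compact, as the
  topology at \<open>Infty\<close> demands.\<close>

lemma continuous_on_rbarI:
  fixes h :: "rbar \<Rightarrow> 'b::topological_space"
  assumes "continuous_on UNIV (\<lambda>t. h (Fin t))" and "((\<lambda>t. h (Fin t)) \<longlongrightarrow> h Infty) at_infinity"
  shows "continuous_on UNIV h"
proof -
  have "open (h -` S)" if "open S" for S
    unfolding open_rbar_def
  proof (intro conjI impI)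
    have eq: "Fin -` (h -` S) = (\<lambda>t. h (Fin t)) -` S" by auto
    show op: "open (Fin -` (h -` S))"
      unfolding eq using assms(1) that by (simp add: continuous_on_open_vimage)
    assume "Infty \<in> h -` S"
    then have "\<forall>\<^sub>F t in at_infinity. h (Fin t) \<in> S"
      using topological_tendstoD[OF assms(2) that] by simp
    then obtain b where b: "\<And>t. b \<le> norm t \<Longrightarrow> h (Fin t) \<in> S"
      by (auto simp: eventually_at_infinity)
    then have "bounded (- (Fin -` (h -` S)))"
      by (intro boundedI[of _ b]) (use linorder_le_cases in auto)
    with op show "compact (- (Fin -` (h -` S)))"
      by (simp add: compact_eq_bounded_closed closed_Compl)
  qed
  then show ?thesis by (simp add: continuous_on_open_vimage)
qed

text \<open>The arctangent carries the compactified line to the interval with its end points glued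
  together, so a function with equal end values is transported without a jump at
  \<open>Infty\<close>.\<close>

lemma continuous_on_arctan_rbar:
  fixes u :: "real \<Rightarrow> 'b::topological_space"
  assumes u: "continuous_on {-pi/2..pi/2} u" and "u (-pi/2) = u (pi/2)"
  shows "((\<lambda>t. u (arctan t)) \<longlongrightarrow> u (pi/2)) at_infinity"
    and "continuous_on UNIV (\<lambda>x. case x of Fin t \<Rightarrow> u (arctan t) | Infty \<Rightarrow> u (pi/2))"
proof -
  have mem: "arctan t \<in> {-pi/2..pi/2}" for t
    using arctan_bounded[of t] by simp
  have "((\<lambda>t. u (arctan t)) \<longlongrightarrow> u (pi/2)) at_top"
    by (rule continuous_on_tendsto_compose[OF u tendsto_arctan_at_top]) (use mem in auto)
  moreover have "((\<lambda>t. u (arctan t)) \<longlongrightarrow> u (- (pi/2))) at_bot"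
    by (rule continuous_on_tendsto_compose[OF u tendsto_arctan_at_bot]) (use mem in auto)
  ultimately show lim: "((\<lambda>t. u (arctan t)) \<longlongrightarrow> u (pi/2)) at_infinity"
    using assms(2) by (simp add: at_infinity_eq_at_top_bot filterlim_sup)
  have "continuous_on UNIV (\<lambda>t. u (arctan t))"
    by (rule continuous_on_compose2[OF u]) (use mem in \<open>auto intro!: continuous_intros\<close>)
  with lim show "continuous_on UNIV (\<lambda>x. case x of Fin t \<Rightarrow> u (arctan t) | Infty \<Rightarrow> u (pi/2))"
    by (intro continuous_on_rbarI) simp_all
qed

text \<open>A sequence in the closure is shadowed by one in S at vanishing distance, and a
  convergent subsequence of the shadow carries the original along. Compactness thus has to be tested
  only on sequences of actual images.\<close>

lemma compact_closure_if_subsequence: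
  fixes S :: "'a::metric_space set"
  assumes sub: "\<And>x. (\<And>n. x n \<in> S) \<Longrightarrow> \<exists>r l. strict_mono (r::nat\<Rightarrow>nat) \<and> (x \<circ> r) \<longlonglongrightarrow> l"
  shows "compact (closure S)"
  unfolding compact_def
proof (intro allI impI)
  fix y :: "nat \<Rightarrow> 'a" assume y: "\<forall>n. y n \<in> closure S"
  have "\<exists>z\<in>S. dist z (y n) < inverse (real (Suc n))" for n
    using y by (simp add: closure_approachable)
  then obtain x where x: "\<And>n. x n \<in> S" "\<And>n. dist (x n) (y n) < inverse (real (Suc n))"
    by metis
  obtain r l where r: "strict_mono r" and l: "(x \<circ> r) \<longlonglongrightarrow> l" using sub x(1) by blast
  have "(\<lambda>n. dist (y n) (x n)) \<longlonglongrightarrow> 0"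
    by (rule tendsto_sandwich[OF _ _ tendsto_const LIMSEQ_inverse_real_of_nat])
       (use x(2) in \<open>auto simp: dist_commute intro!: always_eventually less_imp_le\<close>)
  then have "(\<lambda>n. dist (y (r n)) (x (r n))) \<longlonglongrightarrow> 0"
    using LIMSEQ_subseq_LIMSEQ[OF _ r] by (auto simp: o_def)
  then have "(y \<circ> r) \<longlonglongrightarrow> l"
  proof -
    have 1: "(\<lambda>n. dist (x (r n)) l) \<longlonglongrightarrow> 0"
      using l by (simp add: o_def tendsto_dist_iff[symmetric])
    have 2: "(\<lambda>n. dist (y (r n)) (x (r n)) + dist (x (r n)) l) \<longlonglongrightarrow> 0"
      by (rule tendsto_add_zero[OF \<open>(\<lambda>n. dist (y (r n)) (x (r n))) \<longlonglongrightarrow> 0\<close> 1])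
    have "(\<lambda>n. dist (y (r n)) l) \<longlonglongrightarrow> 0"
      by (rule tendsto_sandwich[OF _ _ tendsto_const 2]) (simp_all add: dist_triangle)
    then show ?thesis by (simp add: o_def tendsto_dist_iff[symmetric])
  qed
  moreover have "l \<in> closure S"
    unfolding closure_sequential using l x(1) by (intro exI[of _ "x \<circ> r"]) simp
  ultimately show "\<exists>l\<in>closure S. \<exists>r. strict_mono r \<and> (y \<circ> r) \<longlonglongrightarrow> l"
    using r by blast
qed

text \<open>The parameter runs over \<open>[-\<pi>/2, \<pi>/2]\<close> with the end points identified; it stands for the
  point \<open>tan b\<close> of the compactified line.\<close>

locale L1_kernel =
  fixes \<kappa> :: "real \<Rightarrow> real \<Rightarrow> biharm" and M :: real
  assumes integrable_kernel: "b \<in> {-pi/2..pi/2} \<Longrightarrow> integrable lborel (\<kappa> b)"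
    and kernel_bound: "b \<in> {-pi/2..pi/2} \<Longrightarrow> (\<integral>s. norm (\<kappa> b s) \<partial>lborel) \<le> M"
    and kernel_continuous: "b \<in> {-pi/2..pi/2} \<Longrightarrow>
      ((\<lambda>c. \<integral>s. norm (\<kappa> c s - \<kappa> b s) \<partial>lborel) \<longlongrightarrow> 0) (at b within {-pi/2..pi/2})"
    and kernel_ends: "\<kappa> (-pi/2) = \<kappa> (pi/2)"
begin

definition U :: "(rbar \<Rightarrow>\<^sub>C biharm) \<Rightarrow> real \<Rightarrow> biharm"
  where "U g b = (\<integral>s. apply_bcontfun g (Fin s) * \<kappa> b s \<partial>lborel)"

text \<open>The value at \<open>Infty\<close> is prescribed as an end value of U and not as a limit;
  \<open>tendsto_U\<close> shows that the two agree.\<close>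

definition V :: "(rbar \<Rightarrow>\<^sub>C biharm) \<Rightarrow> rbar \<Rightarrow> biharm"
  where "V g x = (case x of Fin t \<Rightarrow> U g (arctan t) | Infty \<Rightarrow> U g (pi/2))"

lemma integrable_mult:
  fixes g :: "rbar \<Rightarrow>\<^sub>C biharm"
  assumes "integrable lborel h"
  shows "integrable lborel (\<lambda>s. apply_bcontfun g (Fin s) * h s)"
    and "norm (\<integral>s. apply_bcontfun g (Fin s) * h s \<partial>lborel) \<le> 6 * norm g * (\<integral>s. norm (h s) \<partial>lborel)"
proof -
  have [measurable]: "(\<lambda>s. apply_bcontfun g (Fin s)) \<in> borel_measurable borel"
    by (intro borel_measurable_continuous_onI continuous_on_compose2[OF continuous_on_apply_bcontfun[of UNIV] continuous_on_Fin]) auto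
  have [measurable]: "h \<in> borel_measurable borel"
    using assms by auto
  \<comment> \<open>As the norm is not submultiplicative, measurability of the product is drawn from
    joint continuity of the bounded bilinear multiplication.\<close>
  have meas: "(\<lambda>s. apply_bcontfun g (Fin s) * h s) \<in> borel_measurable lborel"
    using borel_measurable_continuous_Pair[of "\<lambda>s. apply_bcontfun g (Fin s)" borel h "\<lambda>x y. x * y"]
      bounded_bilinear.continuous_on[OF bounded_bilinear_biharm_mult continuous_on_fst[OF continuous_on_id] continuous_on_snd[OF continuous_on_id], of UNIV]
    by (simp add: case_prod_unfold)
  have le: "norm (apply_bcontfun g (Fin s) * h s) \<le> 6 * norm g * norm (h s)" for s
    by (rule order_trans[OF norm_biharm_mult_le]) (intro mult_right_mono mult_left_mono norm_bounded, auto)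
  have int: "integrable lborel (\<lambda>s. 6 * norm g * norm (h s))"
    using assms by simp
  show I: "integrable lborel (\<lambda>s. apply_bcontfun g (Fin s) * h s)"
    by (rule Bochner_Integration.integrable_bound[OF int meas]) (use le in \<open>auto intro!: AE_I2 order_trans[OF le]\<close>)
  have "norm (\<integral>s. apply_bcontfun g (Fin s) * h s \<partial>lborel) \<le> (\<integral>s. norm (apply_bcontfun g (Fin s) * h s) \<partial>lborel)"
    by (rule integral_norm_bound)
  also have "\<dots> \<le> (\<integral>s. 6 * norm g * norm (h s) \<partial>lborel)"
    by (rule integral_mono) (use I int le in auto)
  finally show "norm (\<integral>s. apply_bcontfun g (Fin s) * h s \<partial>lborel) \<le> 6 * norm g * (\<integral>s. norm (h s) \<partial>lborel)"
    by simp
qed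

lemma norm_U_le:
  assumes "b \<in> {-pi/2..pi/2}"
  shows "norm (U g b) \<le> 6 * norm g * M"
  unfolding U_def
  by (rule order_trans[OF integrable_mult(2)[OF integrable_kernel]])
     (use assms kernel_bound in \<open>auto intro!: mult_left_mono\<close>)

text \<open>The bound depends on g only through its norm, which is what makes the image of a bounded
  set equicontinuous.\<close>

lemma norm_U_diff_le:
  assumes "b \<in> {-pi/2..pi/2}" "c \<in> {-pi/2..pi/2}"
  shows "norm (U g c - U g b) \<le> 6 * norm g * (\<integral>s. norm (\<kappa> c s - \<kappa> b s) \<partial>lborel)"
proof -
  have "U g c - U g b = (\<integral>s. apply_bcontfun g (Fin s) * (\<kappa> c s - \<kappa> b s) \<partial>lborel)"
    unfolding U_def right_diff_distrib
    by (subst Bochner_Integration.integral_diff) (auto intro!: integrable_mult integrable_kernel assms)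
  also have "norm \<dots> \<le> 6 * norm g * (\<integral>s. norm (\<kappa> c s - \<kappa> b s) \<partial>lborel)"
    by (intro integrable_mult Bochner_Integration.integrable_diff integrable_kernel assms)
  finally show ?thesis .
qed

lemma U_equicontinuous:
  assumes "b \<in> {-pi/2..pi/2}" "e > 0"
  shows "\<exists>d>0. \<forall>g c. norm g \<le> R \<longrightarrow> c \<in> {-pi/2..pi/2} \<longrightarrow> norm (b - c) < d \<longrightarrow> norm (U g b - U g c) < e"
proof -
  \<comment> \<open>Adding 1 to the absolute value of R keeps the denominator positive for every R
    and makes the final estimate strict.\<close>
  define \<epsilon> where "\<epsilon> = e / (6 * (\<bar>R\<bar> + 1))"
  have \<epsilon>: "\<epsilon> > 0" using assms by (simp add: \<epsilon>_def)
  from tendstoD[OF kernel_continuous[OF assms(1)] \<epsilon>] obtain d where d: "d > 0"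
    "\<And>c. c \<in> {-pi/2..pi/2} \<Longrightarrow> c \<noteq> b \<Longrightarrow> dist c b < d \<Longrightarrow> (\<integral>s. norm (\<kappa> c s - \<kappa> b s) \<partial>lborel) < \<epsilon>"
    by (force simp: eventually_at dist_real_def)
  have "norm (U g b - U g c) < e" if "norm g \<le> R" "c \<in> {-pi/2..pi/2}" "norm (b - c) < d" for g c
  proof -
    \<comment> \<open>The limit in \<open>kernel_continuous\<close> leaves out c = b, where the
      integral is zero.\<close>
    have small: "(\<integral>s. norm (\<kappa> c s - \<kappa> b s) \<partial>lborel) < \<epsilon>"
      using d(2)[of c] that \<epsilon> by (cases "c = b") (auto simp: dist_real_def)
    have "norm (U g b - U g c) \<le> 6 * norm g * (\<integral>s. norm (\<kappa> c s - \<kappa> b s) \<partial>lborel)"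
      using norm_U_diff_le[OF assms(1) that(2)] by (simp add: norm_minus_commute)
    also have "\<dots> \<le> 6 * norm g * \<epsilon>"
      using small by (intro mult_left_mono) auto
    also have "\<dots> < 6 * (\<bar>R\<bar> + 1) * \<epsilon>"
      using that(1) \<epsilon> by (intro mult_strict_right_mono) auto
    also have "\<dots> = e"
      by (simp add: \<epsilon>_def)
    finally show ?thesis .
  qed
  with d(1) show ?thesis by blast
qed

lemma continuous_on_U: "continuous_on {-pi/2..pi/2} (U g)"
  unfolding continuous_on_iff
proof (intro ballI allI impI)
  fix b e :: real assume "b \<in> {-pi/2..pi/2}" "0 < e"
  from U_equicontinuous[OF this, of "norm g"]
  show "\<exists>d>0. \<forall>c\<in>{-pi/2..pi/2}. dist c b < d \<longrightarrow> dist (U g c) (U g b) < e"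
    by (metis dist_commute dist_norm order_refl)
qed

lemma U_ends: "U g (-pi/2) = U g (pi/2)"
  using kernel_ends by (simp add: U_def)

lemma tendsto_U: "((\<lambda>t. U g (arctan t)) \<longlongrightarrow> U g (pi/2)) at_infinity"
  by (rule continuous_on_arctan_rbar[OF continuous_on_U U_ends])

lemma V_bcontfun: "V g \<in> bcontfun"
  unfolding bcontfun_rbar_iff V_def
  by (rule continuous_on_arctan_rbar[OF continuous_on_U U_ends])

lemma linear_V: "linear (\<lambda>g. Bcontfun (V g))"
proof
  have I: "integrable lborel (\<lambda>s. apply_bcontfun g (Fin s) * \<kappa> b s)" if "b \<in> {-pi/2..pi/2}" for g :: "rbar \<Rightarrow>\<^sub>C biharm" and b
    using that by (intro integrable_mult integrable_kernel)
  have mem: "arctan t \<in> {-pi/2..pi/2}" "pi/2 \<in> {-pi/2..pi/2}" for t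
    using arctan_bounded[of t] by auto
  have "U (g + h) b = U g b + U h b" if "b \<in> {-pi/2..pi/2}" for g h b
    using I[OF that] by (simp add: U_def distrib_right)
  then have "V (g + h) = (\<lambda>x. V g x + V h x)" for g h
    using mem by (auto simp: V_def fun_eq_iff split: rbar.split)
  then show "Bcontfun (V (g + h)) = Bcontfun (V g) + Bcontfun (V h)" for g h
    using V_bcontfun by (intro bcontfun_eqI) (simp add: Bcontfun_inverse plus_cont)
  have "U (r *\<^sub>R g) b = r *\<^sub>R U g b" for r g b
    by (simp add: U_def)
  then have "V (r *\<^sub>R g) = (\<lambda>x. r *\<^sub>R V g x)" for r g
    by (auto simp: V_def fun_eq_iff split: rbar.split)
  then show "Bcontfun (V (r *\<^sub>R g)) = r *\<^sub>R Bcontfun (V g)" for r g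
    using V_bcontfun by (intro bcontfun_eqI) (simp add: Bcontfun_inverse scaleR_cont)
qed

text \<open>The Arzela-Ascoli theorem is applied on the compact interval, to the functions
  \<open>U (g n)\<close>, because \<open>rbar\<close> carries only a topology here; the uniform
  limit is then transferred through the arctangent.\<close>

theorem compact_operator_V: "compact_operator (\<lambda>g. Bcontfun (V g))"
  unfolding compact_operator_def
proof (intro conjI allI impI linear_V)
  fix S :: "(rbar \<Rightarrow>\<^sub>C biharm) set" assume "bounded S"
  then obtain R where R: "\<And>g. g \<in> S \<Longrightarrow> norm g \<le> R"
    by (auto simp: bounded_iff)
  show "compact (closure ((\<lambda>g. Bcontfun (V g)) ` S))"
  proof (rule compact_closure_if_subsequence)
    fix x :: "nat \<Rightarrow> rbar \<Rightarrow>\<^sub>C biharm" assume "\<And>n. x n \<in> (\<lambda>g. Bcontfun (V g)) ` S"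
    then obtain g where g: "\<And>n. g n \<in> S" and x: "\<And>n. x n = Bcontfun (V (g n))"
      by (auto simp: image_iff Bex_def) metis
    have M: "0 \<le> M"
      using order_trans[OF Bochner_Integration.integral_nonneg kernel_bound[of 0]] by simp
    have "norm (U (g n) b) \<le> 6 * R * M" if "b \<in> {-pi/2..pi/2}" for n b
      by (rule order_trans[OF norm_U_le[OF that]]) (use R[OF g] M in \<open>intro mult_right_mono; auto\<close>)
    moreover have "\<exists>d>0. \<forall>n c. c \<in> {-pi/2..pi/2} \<and> norm (b - c) < d \<longrightarrow> norm (U (g n) b - U (g n) c) < e"
      if "b \<in> {-pi/2..pi/2}" "0 < e" for b e
      using U_equicontinuous[OF that, of R] R[OF g] by metis
    ultimately obtain u k where k: "strict_mono (k :: nat \<Rightarrow> nat)"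
      and u: "\<And>e. 0 < e \<Longrightarrow> \<exists>N. \<forall>n b. n \<ge> N \<and> b \<in> {-pi/2..pi/2} \<longrightarrow> norm (U (g (k n)) b - u b) < e"
      using Arzela_Ascoli[of "{-pi/2..pi/2}" "\<lambda>n. U (g n)" "6 * R * M"] by (metis compact_Icc)
    \<comment> \<open>Every value of V, also the one at \<open>Infty\<close>, is a value of U on the
      interval, so uniformity is inherited; a uniform limit of elements of \<open>bcontfun\<close>
      is again one.\<close>
    have "uniform_limit UNIV (\<lambda>n. apply_bcontfun (x (k n)))
        (\<lambda>y. case y of Fin t \<Rightarrow> u (arctan t) | Infty \<Rightarrow> u (pi/2)) sequentially"
    proof (rule uniform_limitI)
      fix e :: real assume "0 < e"
      then obtain N where N: "\<And>n b. n \<ge> N \<Longrightarrow> b \<in> {-pi/2..pi/2} \<Longrightarrow> dist (U (g (k n)) b) (u b) < e"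
        using u[of e] by (auto simp: dist_norm)
      have "dist (apply_bcontfun (x (k n)) y) (case y of Fin t \<Rightarrow> u (arctan t) | Infty \<Rightarrow> u (pi/2)) < e"
        if "n \<ge> N" for n y
        using arctan_bounded N[OF that]
        by (cases y) (auto simp: x Bcontfun_inverse V_bcontfun V_def less_imp_le)
      then show "\<forall>\<^sub>F n in sequentially. \<forall>y\<in>UNIV.
          dist (apply_bcontfun (x (k n)) y) (case y of Fin t \<Rightarrow> u (arctan t) | Infty \<Rightarrow> u (pi/2)) < e"
        by (auto simp: eventually_sequentially)
    qed
    from uniform_limit_bcontfunE[OF this sequentially_bot] obtain l where "(\<lambda>n. x (k n)) \<longlonglongrightarrow> l"
      by metis
    with k show "\<exists>r l. strict_mono (r::nat\<Rightarrow>nat) \<and> (x \<circ> r) \<longlonglongrightarrow> l"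
      by (auto simp: o_def)
  qed
qed

end

section \<open>Two facts on integrals over the line\<close>

lemma arctan_in_open_interval: "arctan t \<in> {-pi/2<..<pi/2}"
  using arctan_bounded[of t] by simp

text \<open>The substitution s = tan a as an identity of measures. By uniqueness of Lebesgue measure
  only intervals have to be checked, and there the fundamental theorem of calculus gives tan (arctan
  u) - tan (arctan l) = u - l.\<close>

lemma lborel_eq_distr_tan:
  "lborel = distr (density lborel (\<lambda>a. ennreal (indicator {-pi/2<..<pi/2} a * (1 + (tan a)\<^sup>2)))) borel tan"
proof (rule lborel_eqI)
  have [measurable]: "(tan :: real \<Rightarrow> real) \<in> borel_measurable borel"
    unfolding tan_def[abs_def] by measurable
  fix l u :: real assume "\<And>b. b \<in> Basis \<Longrightarrow> l \<bullet> b \<le> u \<bullet> b"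
  then have lu: "l \<le> u" by simp
  have "emeasure (distr (density lborel (\<lambda>a. ennreal (indicator {-pi/2<..<pi/2} a * (1 + (tan a)\<^sup>2)))) borel tan) (box l u)
      = (\<integral>\<^sup>+a. ennreal (indicator {-pi/2<..<pi/2} a * (1 + (tan a)\<^sup>2)) * indicator (tan -` {l<..<u}) a \<partial>lborel)"
    using measurable_sets_borel[of tan borel "{l<..<u}"] by (subst emeasure_distr) (simp_all add: emeasure_density)
  also have "\<dots> = (\<integral>\<^sup>+a. ennreal (1 + (tan a)\<^sup>2) * indicator {arctan l..arctan u} a \<partial>lborel)"
  proof (rule nn_integral_cong_AE)
    \<comment> \<open>The preimage of the open interval and the closed interval used for integrating
      the derivative differ only in two points.\<close>
    have "AE a in lborel. a \<noteq> arctan l \<and> a \<noteq> arctan u"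
      by (auto simp: AE_lborel_singleton)
    then show "AE a in lborel. ennreal (indicator {-pi/2<..<pi/2} a * (1 + (tan a)\<^sup>2)) * indicator (tan -` {l<..<u}) a
        = ennreal (1 + (tan a)\<^sup>2) * indicator {arctan l..arctan u} a"
    proof eventually_elim
      fix a assume ne: "a \<noteq> arctan l \<and> a \<noteq> arctan u"
      show "ennreal (indicator {-pi/2<..<pi/2} a * (1 + (tan a)\<^sup>2)) * indicator (tan -` {l<..<u}) a
        = ennreal (1 + (tan a)\<^sup>2) * indicator {arctan l..arctan u} a"
      proof (cases "a \<in> {-pi/2<..<pi/2}")
        case True
        then have "arctan (tan a) = a" by (intro arctan_tan) auto
        then have "l < tan a \<longleftrightarrow> arctan l < a" "tan a < u \<longleftrightarrow> a < arctan u"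
          by (metis arctan_less_iff)+
        with True ne show ?thesis by (auto simp: indicator_def)
      next
        case False
        then show ?thesis
          using arctan_in_open_interval[of l] arctan_in_open_interval[of u] by (auto simp: indicator_def)
      qed
    qed
  qed
  also have "\<dots> = ennreal (tan (arctan u) - tan (arctan l))"
  proof (rule nn_integral_FTC_Icc)
    fix a assume "a \<in> {arctan l..arctan u}"
    then have "cos a \<noteq> 0"
      using arctan_in_open_interval[of l] arctan_in_open_interval[of u] by (intro less_imp_neq[symmetric] cos_gt_zero_pi) auto
    then show "DERIV tan a :> 1 + (tan a)\<^sup>2"
      using DERIV_tan[of a] by (simp add: tan_sec power_inverse)
  qed (use lu in \<open>auto simp: arctan_le_iff\<close>)
  finally show "emeasure (distr (density lborel (\<lambda>a. ennreal (indicator {-pi/2<..<pi/2} a * (1 + (tan a)\<^sup>2)))) borel tan) (box l u)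
      = (\<Prod>b\<in>Basis. (u - l) \<bullet> b)"
    by (simp add: tan_arctan)
qed simp

lemma nn_integral_substitution_tan:
  fixes F :: "real \<Rightarrow> ennreal"
  assumes [measurable]: "F \<in> borel_measurable borel"
  shows "(\<integral>\<^sup>+s. F s \<partial>lborel) = (\<integral>\<^sup>+a\<in>{-pi/2<..<pi/2}. ennreal (1 + (tan a)\<^sup>2) * F (tan a) \<partial>lborel)"
proof -
  have [measurable]: "(tan :: real \<Rightarrow> real) \<in> borel_measurable borel"
    unfolding tan_def[abs_def] by measurable
  show ?thesis
    by (subst lborel_eq_distr_tan)
       (auto simp: nn_integral_distr nn_integral_density intro!: nn_integral_cong split: split_indicator)
qed

text \<open>A substitute for dominated convergence when the majorants are translates of one integrable
  function: they are uniformly integrable, so the truncations at a high level are small, uniformly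
  in the translation.\<close>

lemma nn_integral_tendsto_0_translates:
  fixes \<Psi> :: "real \<Rightarrow> ennreal" and u :: "nat \<Rightarrow> real \<Rightarrow> ennreal"
  assumes [measurable]: "\<Psi> \<in> borel_measurable borel" "\<And>n. u n \<in> borel_measurable borel" "A \<in> sets borel"
    and \<Psi>: "(\<integral>\<^sup>+x. \<Psi> x \<partial>lborel) < \<infinity>" and A: "emeasure lborel A < \<infinity>"
    and le: "\<And>n x. x \<in> A \<Longrightarrow> u n x \<le> \<Psi> (x - b n) + \<Psi> (x - c)"
    and lim: "AE x in lborel. x \<in> A \<longrightarrow> (\<lambda>n. u n x) \<longlonglongrightarrow> 0"
  shows "(\<lambda>n. \<integral>\<^sup>+x\<in>A. u n x \<partial>lborel) \<longlonglongrightarrow> 0"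
proof -
  \<comment> \<open>The mass of \<Psi> above the level N, which tends to 0 by dominated convergence
    with \<Psi> itself as majorant.\<close>
  define \<epsilon> where "\<epsilon> N = (\<integral>\<^sup>+x. (\<Psi> x - of_nat N) \<partial>lborel)" for N :: nat
  have \<epsilon>: "\<epsilon> \<longlonglongrightarrow> (\<integral>\<^sup>+x. 0 \<partial>(lborel::real measure))"
    unfolding \<epsilon>_def
  proof (rule nn_integral_dominated_convergence[where w = \<Psi>])
    have "AE x in lborel. \<Psi> x \<noteq> \<infinity>"
      using \<Psi> by (intro nn_integral_noteq_infinite) auto
    then show "AE x in lborel. (\<lambda>N. \<Psi> x - of_nat N) \<longlonglongrightarrow> 0"
    proof eventually_elim
      fix x assume "\<Psi> x \<noteq> \<infinity>"
      then obtain m :: nat where m: "\<Psi> x \<le> of_nat m"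
        by (metis ennreal_Ex_less_of_nat infinity_ennreal_def less_imp_le top.not_eq_extremum)
      have "\<forall>\<^sub>F N in sequentially. \<Psi> x - of_nat N = 0"
        using eventually_ge_at_top[of m]
      proof eventually_elim
        case (elim N)
        then have "(of_nat m :: ennreal) \<le> of_nat N" by (rule of_nat_mono)
        with m have "\<Psi> x \<le> of_nat N" by (rule order_trans)
        then show ?case
          using \<open>\<Psi> x \<noteq> \<infinity>\<close> by (intro diff_eq_0_ennreal) (auto simp: less_top[symmetric])
      qed
      then show "(\<lambda>N. \<Psi> x - of_nat N) \<longlonglongrightarrow> 0"
        by (rule tendsto_eventually)
    qed
  qed (use \<Psi> in \<open>auto intro: diff_le_self_ennreal\<close>)
  \<comment> \<open>Translation invariance makes the excess the same for all translates, hence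
    independent of n.\<close>
  have shift: "(\<integral>\<^sup>+x. \<Psi> (x - d) - of_nat N \<partial>lborel) = \<epsilon> N" for d N
    using nn_integral_real_affine[of "\<lambda>x. \<Psi> x - of_nat N" 1 "-d"] by (simp add: \<epsilon>_def)
  \<comment> \<open>The level is 2N because the majorant is a sum of two translates, each cut at
    N.\<close>
  have main: "(\<integral>\<^sup>+x\<in>A. u n x \<partial>lborel) \<le> (\<integral>\<^sup>+x\<in>A. min (u n x) (of_nat (N + N)) \<partial>lborel) + (\<epsilon> N + \<epsilon> N)" for n N
  proof -
    have pt: "u n x * indicator A x \<le> min (u n x) (of_nat (N + N)) * indicator A x
        + ((\<Psi> (x - b n) - of_nat N) + (\<Psi> (x - c) - of_nat N))" for x
    proof (cases "x \<in> A")
      case True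
      have split: "y \<le> of_nat N + (y - of_nat N)" for y :: ennreal
      proof (cases "y \<le> of_nat N")
        case False
        then show ?thesis by (simp add: add_diff_inverse_ennreal)
      qed (simp add: add_increasing2)
      have "u n x \<le> \<Psi> (x - b n) + \<Psi> (x - c)" using le True by blast
      also have "\<dots> \<le> (of_nat N + (\<Psi> (x - b n) - of_nat N)) + (of_nat N + (\<Psi> (x - c) - of_nat N))"
        by (intro add_mono split)
      also have "\<dots> = of_nat (N + N) + ((\<Psi> (x - b n) - of_nat N) + (\<Psi> (x - c) - of_nat N))"
        by (simp only: of_nat_add ac_simps)
      finally show ?thesis
        using True by (auto simp: min_def)
    qed simp
    have "(\<integral>\<^sup>+x\<in>A. u n x \<partial>lborel) \<le> (\<integral>\<^sup>+x. min (u n x) (of_nat (N + N)) * indicator A x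
        + ((\<Psi> (x - b n) - of_nat N) + (\<Psi> (x - c) - of_nat N)) \<partial>lborel)"
      by (intro nn_integral_mono pt)
    also have "\<dots> = (\<integral>\<^sup>+x\<in>A. min (u n x) (of_nat (N + N)) \<partial>lborel) + (\<epsilon> N + \<epsilon> N)"
      by (simp add: nn_integral_add shift)
    finally show ?thesis .
  qed
  \<comment> \<open>At a fixed level the constant 2N is an integrable majorant, since A has finite
    measure.\<close>
  have trunc: "(\<lambda>n. \<integral>\<^sup>+x\<in>A. min (u n x) (of_nat (N + N)) \<partial>lborel) \<longlonglongrightarrow> (\<integral>\<^sup>+x. 0 \<partial>(lborel::real measure))" for N
  proof (rule nn_integral_dominated_convergence[where w = "\<lambda>x. of_nat (N + N) * indicator A x"])
    show "(\<integral>\<^sup>+x. of_nat (N + N) * indicator A x \<partial>lborel) < \<infinity>"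
      using A by (simp add: nn_integral_cmult ennreal_mult_less_top of_nat_less_top del: of_nat_add)
    show "AE x in lborel. (\<lambda>n. min (u n x) (of_nat (N + N)) * indicator A x) \<longlonglongrightarrow> 0"
      using lim
    proof eventually_elim
      fix x assume *: "x \<in> A \<longrightarrow> (\<lambda>n. u n x) \<longlonglongrightarrow> 0"
      show "(\<lambda>n. min (u n x) (of_nat (N + N)) * indicator A x) \<longlonglongrightarrow> 0"
      proof (cases "x \<in> A")
        case True
        show ?thesis
          by (rule tendsto_sandwich[where f = "\<lambda>_. 0" and h = "\<lambda>n. u n x"]) (simp_all add: * True)
      qed simp
    qed
  qed (simp_all add: mult_right_mono)
  show ?thesis
  proof (rule order_tendstoI)
    fix e :: ennreal assume e: "0 < e"
    have "(\<lambda>N. \<epsilon> N + \<epsilon> N) \<longlonglongrightarrow> 0"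
      using tendsto_add[OF \<epsilon> \<epsilon>] by simp
    from order_tendstoD(2)[OF this e] obtain N where N: "\<epsilon> N + \<epsilon> N < e"
      by (auto simp: eventually_sequentially)
    have "(\<lambda>n. (\<integral>\<^sup>+x\<in>A. min (u n x) (of_nat (N + N)) \<partial>lborel) + (\<epsilon> N + \<epsilon> N)) \<longlonglongrightarrow> \<epsilon> N + \<epsilon> N"
      using tendsto_add[OF trunc[of N] tendsto_const[of "\<epsilon> N + \<epsilon> N"]] by simp
    from order_tendstoD(2)[OF this N]
    show "\<forall>\<^sub>F n in sequentially. (\<integral>\<^sup>+x\<in>A. u n x \<partial>lborel) < e"
      by eventually_elim (rule le_less_trans[OF main])
  qed auto
qed

section \<open>The kernel of a periodic Dini-smooth curve\<close>

lemma bounded_linear_scaleC: "bounded_linear (\<lambda>c. c *\<^sub>\<complex> x)"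
  unfolding linear_conv_bounded_linear[symmetric]
  by (rule linearI) (simp_all add: biharm_eq_iff scaleC_def algebra_simps)

lemma scaleR_scaleC: "r *\<^sub>R (c *\<^sub>\<complex> x) = (r *\<^sub>R c) *\<^sub>\<complex> x"
  by (simp add: biharm_eq_iff scaleC_def)

lemma norm_scaleC: "norm (c *\<^sub>\<complex> x) = norm c * norm x"
  by (simp add: norm_biharm_def scaleC_def norm_mult power_mult_distrib flip: distrib_left)
     (simp add: real_sqrt_mult)

lemma norm_e1: "norm e1 = 1"
  by (simp add: norm_biharm_def e1_def)

lemma norm_rho_le: "norm rho \<le> 4"
  by (rule order_trans[OF norm_biharm_le]) (simp add: rho_def scaleC_def e1_def e2_def norm_mult)

text \<open>Write sin x as 2 tan (x/2) times the square of cos (x/2). The tangent is at least its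
  argument in absolute value, and the square is at least 1/2 because cos x is nonnegative.\<close>

lemma abs_sin_ge_half:
  fixes x :: real
  assumes "\<bar>x\<bar> \<le> pi/2"
  shows "\<bar>x\<bar> / 2 \<le> \<bar>sin x\<bar>"
proof -
  have lt: "\<bar>x/2\<bar> < pi/2"
    using assms pi_gt_zero by linarith
  have pos: "0 < cos (x/2)"
    using lt by (intro cos_gt_zero_pi) auto
  have "0 \<le> cos x"
    using assms by (intro cos_ge_zero) auto
  then have half: "1/2 \<le> (cos (x/2))\<^sup>2"
    using cos_double_cos[of "x/2"] by simp
  have "sin x = 2 * tan (x/2) * (cos (x/2))\<^sup>2"
    using sin_double[of "x/2"] pos by (simp add: tan_def power2_eq_square)
  then have "\<bar>sin x\<bar> = 2 * \<bar>tan (x/2)\<bar> * (cos (x/2))\<^sup>2"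
    by (simp add: abs_mult)
  moreover have "2 * \<bar>x/2\<bar> * (1/2) \<le> 2 * \<bar>tan (x/2)\<bar> * (cos (x/2))\<^sup>2"
    using abs_tan_ge[OF lt] half by (intro mult_mono) auto
  ultimately show ?thesis by simp
qed

text \<open>The difference equals (sin x - x cos x) / (x sin x). The numerator has derivative x sin
  x and is therefore of second order, while the denominator is at least half the square of x in
  absolute value.\<close>

lemma inverse_minus_cot_bound:
  fixes x :: real
  assumes "\<bar>x\<bar> \<le> pi/2" "x \<noteq> 0"
  shows "\<bar>1/x - cot x\<bar> \<le> 2"
proof -
  have s: "\<bar>x\<bar> / 2 \<le> \<bar>sin x\<bar>" "sin x \<noteq> 0"
    using abs_sin_ge_half[OF assms(1)] assms(2) by auto
  have "norm ((sin x - x * cos x) - (sin 0 - 0 * cos (0::real))) \<le> \<bar>x\<bar> * norm (x - 0)"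
  proof (rule field_differentiable_bound[where S = "cball 0 \<bar>x\<bar>" and f' = "\<lambda>y::real. y * sin y"])
    show "((\<lambda>y. sin y - y * cos y) has_field_derivative y * sin y) (at y within cball 0 \<bar>x\<bar>)" for y :: real
      by (auto intro!: derivative_eq_intros simp: algebra_simps)
    show "norm (y * sin y) \<le> \<bar>x\<bar>" if "y \<in> cball 0 \<bar>x\<bar>" for y :: real
      using that mult_mono[of "\<bar>y\<bar>" "\<bar>x\<bar>" "\<bar>sin y\<bar>" 1] by (simp add: abs_mult)
  qed auto
  then have n: "\<bar>sin x - x * cos x\<bar> \<le> \<bar>x\<bar> * \<bar>x\<bar>" by simp
  have "1/x - cot x = (sin x - x * cos x) / (x * sin x)"
    using s(2) assms(2) by (simp add: cot_def field_simps)
  also have "\<bar>\<dots>\<bar> = \<bar>sin x - x * cos x\<bar> / (\<bar>x\<bar> * \<bar>sin x\<bar>)"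
    by (simp add: abs_mult)
  also have "\<dots> \<le> (\<bar>x\<bar> * \<bar>x\<bar>) / (\<bar>x\<bar> * (\<bar>x\<bar> / 2))"
    using n s assms by (intro frac_le mult_left_mono mult_pos_pos) auto
  also have "\<dots> = 2" using assms(2) by simp
  finally show ?thesis .
qed

text \<open>Injectivity up to the period is encoded by the sine, whose zeros are exactly the
  multiples of pi. The function h plays the role of a modulus of continuity of \<open>f'\<close>
  divided by its argument, so that \<open>h_integrable\<close> is the Dini condition.\<close>

locale dini_curve =
  fixes f f' :: "real \<Rightarrow> complex" and h :: "real \<Rightarrow> real"
  assumes deriv: "(f has_vector_derivative f' a) (at a)"
    and cont: "continuous_on UNIV f'"
    and nonzero: "f' a \<noteq> 0"
    and periodic: "f (a + pi) = f a" "f' (a + pi) = f' a"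
    and inj: "f a = f b \<Longrightarrow> sin (a - b) = 0"
    and modulus: "\<bar>x\<bar> \<le> pi/2 \<Longrightarrow> \<bar>y\<bar> \<le> \<bar>x\<bar> \<Longrightarrow> norm (f' (a + y) - f' a) \<le> \<bar>x\<bar> * h x"
    and h_measurable [measurable]: "h \<in> borel_measurable borel"
    and h_nonneg: "0 \<le> h x"
    and h_integrable: "(\<integral>\<^sup>+x\<in>{-pi/2..pi/2}. ennreal (h x) \<partial>lborel) < \<infinity>"
begin

section \<open>Chords of the curve\<close>

lemma continuous_f: "continuous_on UNIV f"
  by (rule continuous_on_vector_derivative) (rule has_vector_derivative_at_within[OF deriv])

lemma measurable_f [measurable]: "f \<in> borel_measurable borel" "f' \<in> borel_measurable borel"
  using cont continuous_f by (auto intro: borel_measurable_continuous_onI)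

lemma linearization:
  assumes "\<And>y. \<bar>y\<bar> \<le> \<bar>x\<bar> \<Longrightarrow> norm (f' (a + y) - f' a) \<le> B"
  shows "norm (f (a + x) - f a - x *\<^sub>R f' a) \<le> \<bar>x\<bar> * B"
proof -
  have "norm (f (a + x) - f a - ((a + x) - a) *\<^sub>R f' a) \<le> norm ((a + x) - a) * B"
  proof (rule vector_differentiable_bound_linearization[where S = "cball a \<bar>x\<bar>"])
    show "closed_segment a (a + x) \<subseteq> cball a \<bar>x\<bar>"
      by (intro closed_segment_subset) (auto simp: dist_norm)
    show "norm (f' y - f' a) \<le> B" if "y \<in> cball a \<bar>x\<bar>" for y
      using assms[of "y - a"] that by (simp add: dist_real_def)
  qed (auto intro: has_vector_derivative_at_within[OF deriv])
  then show ?thesis by simp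
qed

text \<open>For short chords, uniform continuity of \<open>f'\<close> keeps the curve close to its
  tangent, whose length is bounded below. For the remaining ones, compactness and injectivity give a
  positive minimum.\<close>

lemma chord_lower_bound:
  obtains c where "c > 0" and "\<And>b x. b \<in> {-pi/2..pi/2} \<Longrightarrow> \<bar>x\<bar> \<le> pi/2 \<Longrightarrow> c * \<bar>x\<bar> \<le> norm (f (b + x) - f b)"
proof -
  \<comment> \<open>This interval contains every b + y with both b and y of absolute value at most
    pi/2.\<close>
  have "\<exists>z\<in>{-pi..pi}. \<forall>y\<in>{-pi..pi}. norm (f' z) \<le> norm (f' y)"
    by (rule continuous_attains_inf) (auto intro!: continuous_intros continuous_on_subset[OF cont])
  then obtain z where z: "\<And>y. y \<in> {-pi..pi} \<Longrightarrow> norm (f' z) \<le> norm (f' y)" by blast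
  define m where "m = norm (f' z)"
  have m: "m > 0" using nonzero by (simp add: m_def)
  have "uniformly_continuous_on {-pi..pi} f'"
    by (intro compact_uniformly_continuous continuous_on_subset[OF cont]) auto
  then obtain \<delta> where \<delta>: "\<delta> > 0"
    "\<And>x y. x \<in> {-pi..pi} \<Longrightarrow> y \<in> {-pi..pi} \<Longrightarrow> dist y x < \<delta> \<Longrightarrow> dist (f' y) (f' x) < m/2"
    unfolding uniformly_continuous_on_def using m by (metis half_gt_zero)
  have near: "m/2 * \<bar>x\<bar> \<le> norm (f (b + x) - f b)"
    if "b \<in> {-pi/2..pi/2}" "\<bar>x\<bar> \<le> pi/2" "\<bar>x\<bar> < \<delta>" for b x
  proof -
    have "norm (f' (b + y) - f' b) \<le> m/2" if "\<bar>y\<bar> \<le> \<bar>x\<bar>" for y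
    proof -
      have "b + y \<in> {-pi..pi}" "b \<in> {-pi..pi}" "\<bar>y\<bar> < \<delta>"
        using that \<open>b \<in> _\<close> \<open>\<bar>x\<bar> \<le> _\<close> \<open>\<bar>x\<bar> < _\<close> unfolding atLeastAtMost_iff by linarith+
      with \<delta>(2)[of b "b + y"] show ?thesis by (simp add: dist_norm)
    qed
    from linearization[OF this, of x] have "norm (f (b + x) - f b - x *\<^sub>R f' b) \<le> \<bar>x\<bar> * (m/2)" by simp
    moreover have "\<bar>x\<bar> * m \<le> norm (x *\<^sub>R f' b)"
      using z[of b] that(1) by (auto simp: m_def intro!: mult_left_mono)
    ultimately show ?thesis
      using norm_triangle_ineq4[of "f (b + x) - f b" "f (b + x) - f b - x *\<^sub>R f' b"]
      by (simp add: field_simps)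
  qed
  define X where "X = {-pi/2..pi/2} \<times> ({-pi/2..pi/2} \<inter> {x::real. \<delta> \<le> \<bar>x\<bar>})"
  have X: "compact X"
    unfolding X_def by (intro compact_Times compact_Int_closed closed_Collect_le continuous_intros) auto
  have "\<exists>c>0. \<forall>p\<in>X. c \<le> norm (f (fst p + snd p) - f (fst p))"
  proof (cases "X = {}")
    case False
    have "\<exists>q\<in>X. \<forall>p\<in>X. norm (f (fst q + snd q) - f (fst q)) \<le> norm (f (fst p + snd p) - f (fst p))"
      by (rule continuous_attains_inf[OF X False])
         (auto intro!: continuous_intros continuous_on_compose2[OF continuous_f])
    then obtain q where q: "q \<in> X" "\<And>p. p \<in> X \<Longrightarrow> norm (f (fst q + snd q) - f (fst q)) \<le> norm (f (fst p + snd p) - f (fst p))"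
      by blast
    have "sin (snd q) \<noteq> 0"
    proof -
      have "\<bar>snd q\<bar> \<le> pi/2" "0 < \<bar>snd q\<bar>"
        using q(1) \<delta>(1) by (auto simp: X_def abs_le_iff)
      with abs_sin_ge_half[of "snd q"] show ?thesis by auto
    qed
    then have "f (fst q + snd q) \<noteq> f (fst q)"
      using inj[of "fst q + snd q" "fst q"] by auto
    with q(2) show ?thesis
      by (intro exI[of _ "norm (f (fst q + snd q) - f (fst q))"]) auto
  qed (auto intro: exI[of _ 1])
  then obtain c where c: "c > 0" "\<And>b x. (b, x) \<in> X \<Longrightarrow> c \<le> norm (f (b + x) - f b)"
    by fastforce
  \<comment> \<open>The factor 1/2 turns a constant bound into a linear one, since pi/2 < 2.\<close>
  have far: "c/2 * \<bar>x\<bar> \<le> norm (f (b + x) - f b)"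
    if "b \<in> {-pi/2..pi/2}" "\<bar>x\<bar> \<le> pi/2" "\<delta> \<le> \<bar>x\<bar>" for b x
  proof -
    have "c/2 * \<bar>x\<bar> \<le> c/2 * 2"
      using that pi_less_4 c(1) by (intro mult_left_mono) auto
    also have "\<dots> \<le> norm (f (b + x) - f b)"
    proof -
      have "x \<in> {-pi/2..pi/2}" using that(2) unfolding atLeastAtMost_iff by linarith
      with that c(2)[of b x] show ?thesis by (simp add: X_def)
    qed
    finally show ?thesis .
  qed
  show ?thesis
  proof (rule that[of "min (m/2) (c/2)"])
    show "min (m/2) (c/2) * \<bar>x\<bar> \<le> norm (f (b + x) - f b)"
      if "b \<in> {-pi/2..pi/2}" "\<bar>x\<bar> \<le> pi/2" for b x
    proof (cases "\<bar>x\<bar> < \<delta>")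
      case True
      show ?thesis by (rule order_trans[OF mult_right_mono near[OF that True]]) auto
    next
      case False
      then have "\<delta> \<le> \<bar>x\<bar>" by simp
      show ?thesis by (rule order_trans[OF mult_right_mono far[OF that \<open>\<delta> \<le> \<bar>x\<bar>\<close>]]) auto
    qed
  qed (use m c in auto)
qed

section \<open>The kernel in the angular variable\<close>

definition K1 :: "real \<Rightarrow> real \<Rightarrow> complex"
  where "K1 b a = f' a / (f a - f b) - of_real (cot (a - b))"

definition K2 :: "real \<Rightarrow> real \<Rightarrow> complex"
  where "K2 b a = - of_real (Im (K1 b a)) * cnj (f a - f b) / (2 * (f a - f b))"

definition K :: "real \<Rightarrow> real \<Rightarrow> biharm"
  where "K b a = K1 b a *\<^sub>\<complex> e1 + (\<i> * K2 b a) *\<^sub>\<complex> rho"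

lemma cot_periodic: "cot (x + pi) = cot x" for x :: real
  by (simp add: cot_def)

lemma K_periodic: "K b (a + pi) = K b a" "K (b + pi) a = K b a"
proof -
  have "cot (a - (b + pi)) = cot (a - b)" "cot ((a + pi) - b) = cot (a - b)"
    using cot_periodic[of "a - (b + pi)"] cot_periodic[of "a - b"] by (simp_all add: algebra_simps)
  then show "K b (a + pi) = K b a" "K (b + pi) a = K b a"
    by (simp_all only: K_def K1_def K2_def periodic)
qed

lemma measurable_K [measurable]: "K b \<in> borel_measurable borel"
proof -
  have [measurable]: "(\<lambda>a. cot (a - b)) \<in> borel_measurable borel"
    unfolding cot_def by measurable
  have [measurable]: "K1 b \<in> borel_measurable borel"
    unfolding K1_def by measurable
  have [measurable]: "(\<lambda>a. cnj (f a - f b)) \<in> borel_measurable borel"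
    by (intro borel_measurable_continuous_onI continuous_intros continuous_f)
  have [measurable]: "K2 b \<in> borel_measurable borel"
    unfolding K2_def by measurable
  have [measurable]: "(\<lambda>a. u a *\<^sub>\<complex> x) \<in> borel_measurable borel" if "u \<in> borel_measurable borel" for u :: "real \<Rightarrow> complex" and x
    using that by (rule measurable_compose)
      (intro borel_measurable_continuous_onI linear_continuous_on bounded_linear_scaleC)
  show ?thesis unfolding K_def by measurable
qed

text \<open>A number and its conjugate have the same modulus, so K2 is at most half of K1; with
  \<open>norm rho\<close> at most 4 the total is 1 + 4/2 = 3.\<close>

lemma norm_K_le: "norm (K b a) \<le> 3 * norm (K1 b a)"
proof -
  have "norm (K2 b a) \<le> norm (K1 b a) / 2"
  proof (cases "f a = f b")
    case False
    then have "norm (K2 b a) = \<bar>Im (K1 b a)\<bar> / 2"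
      unfolding K2_def norm_divide norm_mult norm_minus_cancel complex_mod_cnj norm_of_real norm_numeral by simp
    then show ?thesis using abs_Im_le_cmod[of "K1 b a"] by simp
  qed (simp add: K2_def)
  then have "norm (K2 b a) * norm rho \<le> norm (K1 b a) / 2 * 4"
    by (intro mult_mono norm_rho_le) auto
  then show ?thesis
    unfolding K_def by (intro order_trans[OF norm_triangle_ineq]) (simp add: norm_scaleC norm_e1 norm_mult)
qed

text \<open>Insert 1/x: the difference of the logarithmic derivative and 1/x is controlled by
  linearization and the chord bound, that of 1/x and the cotangent by an absolute constant.\<close>

lemma K_bound:
  obtains C where "C \<ge> 0" and "\<And>b x. b \<in> {-pi/2..pi/2} \<Longrightarrow> \<bar>x\<bar> \<le> pi/2 \<Longrightarrow> norm (K b (b + x)) \<le> C * h x + C"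
proof -
  obtain c where c: "c > 0" "\<And>b x. b \<in> {-pi/2..pi/2} \<Longrightarrow> \<bar>x\<bar> \<le> pi/2 \<Longrightarrow> c * \<bar>x\<bar> \<le> norm (f (b + x) - f b)"
    using chord_lower_bound by blast
  have K1: "norm (K1 b (b + x)) \<le> h x / c + 2" if b: "b \<in> {-pi/2..pi/2}" and x: "\<bar>x\<bar> \<le> pi/2" for b x
  proof (cases "x = 0")
    \<comment> \<open>On the diagonal both terms of K1 are 0 by the convention for division by
      zero.\<close>
    case True
    then show ?thesis using c(1) h_nonneg[of x] by (simp add: K1_def cot_def)
  next
    case False
    define \<Delta> where "\<Delta> = f (b + x) - f b"
    have \<Delta>: "c * \<bar>x\<bar> \<le> norm \<Delta>" using c(2)[OF b x] by (simp add: \<Delta>_def)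
    with False c(1) have \<Delta>0: "\<Delta> \<noteq> 0" by (auto simp: mult_le_0_iff)
    \<comment> \<open>The linearization runs backwards from b + x, because this is where K1
      evaluates the derivative.\<close>
    have "norm (f (b + x + - x) - f (b + x) - (- x) *\<^sub>R f' (b + x)) \<le> \<bar>- x\<bar> * (\<bar>x\<bar> * h x)"
      by (rule linearization) (use modulus[OF x] in auto)
    also have "f (b + x + - x) - f (b + x) - (- x) *\<^sub>R f' (b + x) = f' (b + x) * x - \<Delta>"
      by (simp add: \<Delta>_def scaleR_conv_of_real algebra_simps)
    finally have num: "norm (f' (b + x) * x - \<Delta>) \<le> \<bar>x\<bar> * (\<bar>x\<bar> * h x)" by simp
    have "f' (b + x) / \<Delta> - of_real (1/x) = (f' (b + x) * x - \<Delta>) / (\<Delta> * x)"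
      using False \<Delta>0 by (simp add: field_simps)
    also have "norm \<dots> = norm (f' (b + x) * x - \<Delta>) / (norm \<Delta> * \<bar>x\<bar>)"
      by (simp add: norm_divide norm_mult)
    also have "\<dots> \<le> (\<bar>x\<bar> * (\<bar>x\<bar> * h x)) / ((c * \<bar>x\<bar>) * \<bar>x\<bar>)"
      using num \<Delta> False c(1) h_nonneg[of x] by (intro frac_le mult_right_mono) auto
    also have "\<dots> = h x / c" using False by simp
    finally have 1: "norm (f' (b + x) / \<Delta> - of_real (1/x)) \<le> h x / c" .
    have "norm (complex_of_real (1/x) - of_real (cot x)) \<le> 2"
      using inverse_minus_cot_bound[OF x False] by (simp only: of_real_diff[symmetric] norm_of_real)
    with 1 norm_triangle_ineq[of "f' (b + x) / \<Delta> - of_real (1/x)" "of_real (1/x) - of_real (cot x)"]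
    show ?thesis by (simp add: K1_def \<Delta>_def)
  qed
  show ?thesis
  proof (rule that[of "3/c + 6"])
    fix b x assume b: "b \<in> {-pi/2..pi/2}" and x: "\<bar>x\<bar> \<le> pi/2"
    have "norm (K b (b + x)) \<le> 3 * (h x / c + 2)"
      by (rule order_trans[OF norm_K_le mult_left_mono[OF K1[OF b x]]]) simp
    also have "\<dots> \<le> (3/c + 6) * h x + (3/c + 6)"
      using c(1) h_nonneg[of x] by (simp add: algebra_simps)
    finally show "norm (K b (b + x)) \<le> (3/c + 6) * h x + (3/c + 6)" .
  qed (use c in auto)
qed

text \<open>\<open>K_bound\<close> reaches only differences up to pi/2, whereas a - b can come close
  to pi or -pi. As K has period pi in a, a shift by 0, pi or -pi brings the difference into range,
  so three translates of one function suffice.\<close>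

lemma K_dominated:
  obtains \<Psi> :: "real \<Rightarrow> ennreal" where "\<Psi> \<in> borel_measurable borel" "(\<integral>\<^sup>+x. \<Psi> x \<partial>lborel) < \<infinity>"
    and "\<And>b a. b \<in> {-pi/2..pi/2} \<Longrightarrow> a \<in> {-pi/2<..<pi/2} \<Longrightarrow> ennreal (norm (K b a)) \<le> \<Psi> (a - b)"
proof -
  obtain C where C: "C \<ge> 0" "\<And>b x. b \<in> {-pi/2..pi/2} \<Longrightarrow> \<bar>x\<bar> \<le> pi/2 \<Longrightarrow> norm (K b (b + x)) \<le> C * h x + C"
    using K_bound by blast
  define H :: "real \<Rightarrow> ennreal" where "H x = ennreal (C * h x + C) * indicator {-pi/2..pi/2} x" for x
  have [measurable]: "H \<in> borel_measurable borel" unfolding H_def by measurable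
  have "(\<integral>\<^sup>+x. H x \<partial>lborel) = (\<integral>\<^sup>+x. ennreal C * (ennreal (h x) * indicator {-pi/2..pi/2} x) + ennreal C * indicator {-pi/2..pi/2} x \<partial>lborel)"
    using C(1) h_nonneg by (intro nn_integral_cong) (auto simp: H_def ennreal_mult split: split_indicator)
  also have "\<dots> = ennreal C * (\<integral>\<^sup>+x\<in>{-pi/2..pi/2}. ennreal (h x) \<partial>lborel) + ennreal C * emeasure lborel {-pi/2..pi/2}"
    by (simp add: nn_integral_add nn_integral_cmult)
  also have "\<dots> < \<infinity>"
    using h_integrable by (simp add: ennreal_mult_less_top)
  finally have H: "(\<integral>\<^sup>+x. H x \<partial>lborel) < \<infinity>" .
  have shift: "(\<integral>\<^sup>+x. H (x + d) \<partial>lborel) = (\<integral>\<^sup>+x. H x \<partial>lborel)" for d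
    using nn_integral_real_affine[of H 1 d] by (simp add: add.commute)
  show ?thesis
  proof (rule that[of "\<lambda>x. H x + H (x + pi) + H (x + (- pi))"])
    show "(\<integral>\<^sup>+x. H x + H (x + pi) + H (x + - pi) \<partial>lborel) < \<infinity>"
      using H by (simp add: nn_integral_add shift del: add_uminus_conv_diff)
    fix b a :: real assume b: "b \<in> {-pi/2..pi/2}" and a: "a \<in> {-pi/2<..<pi/2}"
    have *: "ennreal (norm (K b (b + x))) \<le> H x" if "\<bar>x\<bar> \<le> pi/2" for x
    proof -
      have "x \<in> {-pi/2..pi/2}" using that unfolding atLeastAtMost_iff by linarith
      then show ?thesis using C(2)[OF b that] by (simp add: H_def ennreal_leI)
    qed
    consider "\<bar>a - b\<bar> \<le> pi/2" | "\<bar>a - b + pi\<bar> \<le> pi/2" | "\<bar>a - b + - pi\<bar> \<le> pi/2"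
      using a b unfolding atLeastAtMost_iff greaterThanLessThan_iff by linarith
    then show "ennreal (norm (K b a)) \<le> H (a - b) + H (a - b + pi) + H (a - b + - pi)"
    proof cases
      case 1
      from *[OF this] show ?thesis by (simp add: add_increasing2)
    next
      case 2
      from *[OF this] K_periodic(1)[of b a] show ?thesis by (simp add: add_increasing add_increasing2 ac_simps)
    next
      case 3
      from *[OF this] K_periodic(1)[of b "a - pi"] show ?thesis by (simp add: add_increasing add_increasing2)
    qed
  qed simp
qed

lemma tendsto_K:
  assumes "b \<longlonglongrightarrow> b0" "sin (a - b0) \<noteq> 0"
  shows "(\<lambda>n. K (b n) a) \<longlonglongrightarrow> K b0 a"
proof -
  have ne: "f a - f b0 \<noteq> 0" using inj[of a b0] assms(2) by auto
  have f: "(\<lambda>n. f (b n)) \<longlonglongrightarrow> f b0"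
    by (rule continuous_on_tendsto_compose[OF continuous_f assms(1)]) auto
  have K1: "(\<lambda>n. K1 (b n) a) \<longlonglongrightarrow> K1 b0 a"
    unfolding K1_def cot_def by (intro tendsto_intros f assms ne)
  have K2: "(\<lambda>n. K2 (b n) a) \<longlonglongrightarrow> K2 b0 a"
    unfolding K2_def using ne by (intro tendsto_intros f K1) auto
  show ?thesis
    unfolding K_def
    by (intro tendsto_add bounded_linear.tendsto[OF bounded_linear_scaleC] K1 tendsto_mult tendsto_const K2)
qed

text \<open>The kernels converge pointwise off the diagonal, but their majorants move with
  \<open>b n\<close>, so the convergence lemma for translates replaces dominated
  convergence.\<close>

lemma K_L1_continuous:
  assumes b: "\<And>n. b n \<in> {-pi/2..pi/2}" "b0 \<in> {-pi/2..pi/2}" and lim: "b \<longlonglongrightarrow> b0"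
  shows "(\<lambda>n. \<integral>\<^sup>+a\<in>{-pi/2<..<pi/2}. ennreal (norm (K (b n) a - K b0 a)) \<partial>lborel) \<longlonglongrightarrow> 0"
proof -
  obtain \<Psi> :: "real \<Rightarrow> ennreal" where \<Psi>: "\<Psi> \<in> borel_measurable borel" "(\<integral>\<^sup>+x. \<Psi> x \<partial>lborel) < \<infinity>"
    "\<And>b a. b \<in> {-pi/2..pi/2} \<Longrightarrow> a \<in> {-pi/2<..<pi/2} \<Longrightarrow> ennreal (norm (K b a)) \<le> \<Psi> (a - b)"
    using K_dominated by blast
  show ?thesis
  proof (rule nn_integral_tendsto_0_translates[OF \<Psi>(1) _ _ \<Psi>(2)])
    fix n a assume a: "a \<in> {-pi/2<..<pi/2}"
    have "ennreal (norm (K (b n) a - K b0 a)) \<le> ennreal (norm (K (b n) a)) + ennreal (norm (K b0 a))"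
      by (simp add: norm_triangle_ineq4 flip: ennreal_plus)
    also have "\<dots> \<le> \<Psi> (a - b n) + \<Psi> (a - b0)"
      by (intro add_mono \<Psi> b a)
    finally show "ennreal (norm (K (b n) a - K b0 a)) \<le> \<Psi> (a - b n) + \<Psi> (a - b0)" .
  next
    have "AE a in lborel. a \<noteq> b0" by (simp add: AE_lborel_singleton)
    then show "AE a in lborel. a \<in> {-pi/2<..<pi/2} \<longrightarrow> (\<lambda>n. ennreal (norm (K (b n) a - K b0 a))) \<longlonglongrightarrow> 0"
    proof (eventually_elim, intro impI)
      fix a assume ne: "a \<noteq> b0" and a: "a \<in> {-pi/2<..<pi/2}"
      \<comment> \<open>Within this range the sine vanishes only at 0.\<close>
      have "\<bar>a - b0\<bar> < pi" using a b(2) by auto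
      with ne have "sin (a - b0) \<noteq> 0" by (metis eq_iff_diff_eq_0 sin_eq_0_pi abs_less_iff minus_less_iff)
      from tendsto_norm_zero[OF LIM_zero[OF tendsto_K[OF lim this]]]
      show "(\<lambda>n. ennreal (norm (K (b n) a - K b0 a))) \<longlonglongrightarrow> 0"
        using tendsto_ennrealI by fastforce
    qed
  qed simp_all
qed


text \<open>The weight is the Jacobian of a = arctan s, so that the L1 norm of
  \<open>\<kappa> b\<close> on the line is that of \<open>K b\<close> over one period.\<close>

definition \<kappa> :: "real \<Rightarrow> real \<Rightarrow> biharm"
  where "\<kappa> b s = (1 / (1 + s\<^sup>2)) *\<^sub>R K b (arctan s)"

lemma measurable_kernel [measurable]: "\<kappa> b \<in> borel_measurable borel"
proof -
  have [measurable]: "(\<lambda>s. K b (arctan s)) \<in> borel_measurable borel"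
    using measurable_compose[OF borel_measurable_continuous_onI[of arctan] measurable_K[of b]]
    by (auto intro!: continuous_intros)
  show ?thesis unfolding \<kappa>_def by measurable
qed

lemma nn_integral_arctan_pullback:
  fixes F :: "real \<Rightarrow> biharm"
  assumes [measurable]: "(\<lambda>s. (1 / (1 + s\<^sup>2)) *\<^sub>R F (arctan s)) \<in> borel_measurable borel"
  shows "(\<integral>\<^sup>+s. ennreal (norm ((1 / (1 + s\<^sup>2)) *\<^sub>R F (arctan s))) \<partial>lborel)
    = (\<integral>\<^sup>+a\<in>{-pi/2<..<pi/2}. ennreal (norm (F a)) \<partial>lborel)"
proof (subst nn_integral_substitution_tan)
  have "ennreal (1 + (tan a)\<^sup>2) * ennreal (norm ((1 / (1 + (tan a)\<^sup>2)) *\<^sub>R F (arctan (tan a)))) = ennreal (norm (F a))"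
    if "a \<in> {-pi/2<..<pi/2}" for a
  proof -
    have "0 < 1 + (tan a)\<^sup>2" by (simp add: add_pos_nonneg)
    moreover have "arctan (tan a) = a" using that by (intro arctan_tan) auto
    ultimately show ?thesis by (simp add: ennreal_mult[symmetric] del: ennreal_plus)
  qed
  then show "(\<integral>\<^sup>+a\<in>{-pi/2<..<pi/2}. ennreal (1 + (tan a)\<^sup>2) * ennreal (norm ((1 / (1 + (tan a)\<^sup>2)) *\<^sub>R F (arctan (tan a)))) \<partial>lborel)
    = (\<integral>\<^sup>+a\<in>{-pi/2<..<pi/2}. ennreal (norm (F a)) \<partial>lborel)"
    by (intro nn_integral_cong) (simp split: split_indicator)
qed measurable

text \<open>Since \<Psi> enters only through translates, its integral bounds the L1 norms of all
  \<open>\<kappa> b\<close> at once.\<close>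

lemma L1_kernel: "\<exists>M. L1_kernel \<kappa> M"
proof -
  obtain \<Psi> :: "real \<Rightarrow> ennreal" where \<Psi>: "\<Psi> \<in> borel_measurable borel" "(\<integral>\<^sup>+x. \<Psi> x \<partial>lborel) < \<infinity>"
    "\<And>b a. b \<in> {-pi/2..pi/2} \<Longrightarrow> a \<in> {-pi/2<..<pi/2} \<Longrightarrow> ennreal (norm (K b a)) \<le> \<Psi> (a - b)"
    using K_dominated by blast
  note [measurable] = \<Psi>(1)
  have norm_le: "(\<integral>\<^sup>+s. ennreal (norm (\<kappa> b s)) \<partial>lborel) \<le> (\<integral>\<^sup>+x. \<Psi> x \<partial>lborel)" if "b \<in> {-pi/2..pi/2}" for b
  proof -
    have "(\<integral>\<^sup>+s. ennreal (norm (\<kappa> b s)) \<partial>lborel) = (\<integral>\<^sup>+a\<in>{-pi/2<..<pi/2}. ennreal (norm (K b a)) \<partial>lborel)"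
      unfolding \<kappa>_def by (rule nn_integral_arctan_pullback) (use measurable_kernel in \<open>simp add: \<kappa>_def[abs_def]\<close>)
    also have "\<dots> \<le> (\<integral>\<^sup>+a. \<Psi> (a - b) \<partial>lborel)"
      using \<Psi>(3)[OF that] by (intro nn_integral_mono) (simp split: split_indicator)
    also have "\<dots> = (\<integral>\<^sup>+x. \<Psi> x \<partial>lborel)"
      using nn_integral_real_affine[of \<Psi> 1 "-b"] by simp
    finally show ?thesis .
  qed
  have diff: "(\<integral>\<^sup>+s. ennreal (norm (\<kappa> c s - \<kappa> b s)) \<partial>lborel)
      = (\<integral>\<^sup>+a\<in>{-pi/2<..<pi/2}. ennreal (norm (K c a - K b a)) \<partial>lborel)" for b c
  proof -
    have *: "\<kappa> c s - \<kappa> b s = (1 / (1 + s\<^sup>2)) *\<^sub>R (K c (arctan s) - K b (arctan s))" for s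
      by (simp add: \<kappa>_def scaleR_diff_right)
    have "(\<lambda>s. (1 / (1 + s\<^sup>2)) *\<^sub>R (K c (arctan s) - K b (arctan s))) \<in> borel_measurable borel"
      unfolding *[symmetric] by measurable
    from nn_integral_arctan_pullback[OF this] show ?thesis unfolding * .
  qed
  have "L1_kernel \<kappa> (enn2real (\<integral>\<^sup>+x. \<Psi> x \<partial>lborel))"
  proof
    fix b :: real assume b: "b \<in> {-pi/2..pi/2}"
    show int: "integrable lborel (\<kappa> b)"
      using norm_le[OF b] \<Psi>(2) by (simp add: integrable_iff_bounded)
    show "(\<integral>s. norm (\<kappa> b s) \<partial>lborel) \<le> enn2real (\<integral>\<^sup>+x. \<Psi> x \<partial>lborel)"
      using norm_le[OF b] \<Psi>(2) by (subst integral_eq_nn_integral) (auto intro!: enn2real_mono)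
    \<comment> \<open>Continuity is tested along sequences, to which \<open>K_L1_continuous\<close>
      applies.\<close>
    have "((\<lambda>c. \<integral>\<^sup>+s. ennreal (norm (\<kappa> c s - \<kappa> b s)) \<partial>lborel) \<longlongrightarrow> 0) (at b within {-pi/2..pi/2})"
      unfolding tendsto_at_iff_sequentially diff comp_def
      using b by (intro allI impI K_L1_continuous) simp_all
    then have "((\<lambda>c. enn2real (\<integral>\<^sup>+s. ennreal (norm (\<kappa> c s - \<kappa> b s)) \<partial>lborel)) \<longlongrightarrow> 0) (at b within {-pi/2..pi/2})"
      by (intro tendsto_enn2real) auto
    then show "((\<lambda>c. \<integral>s. norm (\<kappa> c s - \<kappa> b s) \<partial>lborel) \<longlongrightarrow> 0) (at b within {-pi/2..pi/2})"
      by (subst integral_eq_nn_integral) auto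
  next
    show "\<kappa> (-pi/2) = \<kappa> (pi/2)"
      using K_periodic(2)[of "-pi/2"] by (simp add: \<kappa>_def[abs_def] field_simps)
  qed
  then show ?thesis by blast
qed

end

section \<open>The boundary curve of a conformal mapping\<close>

lemma norm_cis_diff_le: "norm (cis u - cis v) \<le> \<bar>u - v\<bar>"
proof -
  have "cis u - cis v = cis v * (exp (\<i> * of_real (u - v)) - 1)"
    unfolding cis_conv_exp[symmetric] by (simp add: right_diff_distrib cis_mult)
  then have "norm (cis u - cis v) = 2 * \<bar>sin ((u - v) / 2)\<bar>"
    by (simp add: norm_mult dist_exp_i_1 del: of_real_diff)
  also have "\<dots> \<le> 2 * \<bar>(u - v) / 2\<bar>"
    by (intro mult_left_mono abs_sin_x_le_abs_x) auto
  finally show ?thesis by simp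
qed

text \<open>The unit vector at angle arctan t points along 1 + it, so its square is (1 + it) / (1 -
  it), which is minus the Cayley transform of t.\<close>

lemma cis_double_arctan: "- cis (2 * arctan t) = (of_real t - \<i>) / (of_real t + \<i>)"
proof -
  have pos: "0 < 1 + t\<^sup>2" by (simp add: add_pos_nonneg)
  have ne: "of_real t + \<i> \<noteq> 0" "1 - \<i> * of_real t \<noteq> 0" by (auto simp: complex_eq_iff)
  have "cis (arctan t) = (1 + \<i> * of_real t) / of_real (sqrt (1 + t\<^sup>2))"
    by (simp add: complex_eq_iff cos_arctan sin_arctan Re_divide_of_real Im_divide_of_real)
  moreover have "cis (2 * arctan t) = (cis (arctan t))\<^sup>2"
    by (simp add: power2_eq_square cis_mult)
  ultimately have "cis (2 * arctan t) = (1 + \<i> * of_real t)\<^sup>2 / of_real (1 + t\<^sup>2)"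
    using pos by (simp add: power_divide flip: of_real_power)
  also have "of_real (1 + t\<^sup>2) = (1 + \<i> * of_real t) * (1 - \<i> * of_real t)"
    by (simp add: algebra_simps power2_eq_square)
  also have "(1 + \<i> * of_real t)\<^sup>2 / \<dots> = (1 + \<i> * of_real t) / (1 - \<i> * of_real t)"
    using pos by (auto simp: power2_eq_square complex_eq_iff)
  also have "\<dots> = - ((of_real t - \<i>) / (of_real t + \<i>))"
    using ne by (simp add: field_simps)
  finally show ?thesis by simp
qed

text \<open>The addition formulas leave a common factor of two cosines. This identity turns the term
  subtracted in \<open>k1\<close> into a cotangent times the Jacobian; for s = t both sides are 0 by
  the convention for division.\<close>

lemma cot_arctan_diff:
  "cot (arctan s - arctan t) = (1 + s * t) / (s - t)"
proof (cases "s = t")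
  case False
  have pos: "0 < 1 + s\<^sup>2" "0 < 1 + t\<^sup>2" by (simp_all add: add_pos_nonneg)
  have "cot (arctan s - arctan t) = (cos (arctan s) * cos (arctan t) * (1 + s * t)) / (cos (arctan s) * cos (arctan t) * (s - t))"
    unfolding cot_def cos_diff sin_diff
    by (simp add: cos_arctan sin_arctan algebra_simps diff_divide_distrib add_divide_distrib)
  then show ?thesis by simp
qed (simp add: cot_def)

locale dini_circle_map =
  fixes \<sigma> \<sigma>' :: "complex \<Rightarrow> complex"
  assumes inj_circle: "inj_on \<sigma> (sphere 0 1)"
    and contour: "contour_derivative \<sigma> \<sigma>'"
    and continuous: "continuous_on (sphere 0 1) \<sigma>'"
    and nonzero: "T \<in> sphere 0 1 \<Longrightarrow> \<sigma>' T \<noteq> 0"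
    and dini: "(\<integral>\<^sup>+ \<eta>\<in>{0<..<1}. ennreal (circle_modulus \<sigma>' \<eta> / \<eta>) \<partial>lborel) < \<infinity>"
begin

section \<open>The modulus of continuity of the contour derivative\<close>

definition B :: real
  where "B = (SOME B. \<forall>T\<in>sphere 0 1. norm (\<sigma>' T) \<le> B)"

lemma norm_le_B: "norm T = 1 \<Longrightarrow> norm (\<sigma>' T) \<le> B"
proof -
  have "bounded (\<sigma>' ` sphere 0 1)"
    by (intro compact_imp_bounded compact_continuous_image continuous) simp
  then have "\<exists>B. \<forall>T\<in>sphere 0 1. norm (\<sigma>' T) \<le> B"
    by (simp add: bounded_iff)
  then have "\<forall>T\<in>sphere 0 1. norm (\<sigma>' T) \<le> B"
    unfolding B_def by (rule someI_ex)
  then show "norm T = 1 \<Longrightarrow> norm (\<sigma>' T) \<le> B" by simp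
qed

lemma B_nonneg: "0 \<le> B"
  using order_trans[OF norm_ge_zero norm_le_B[of 1]] by simp

text \<open>The argument is truncated at 0 since \<^const>\<open>circle_modulus\<close> is the supremum of the empty
  set at negative arguments.\<close>

definition w :: "real \<Rightarrow> real"
  where "w r = circle_modulus \<sigma>' (max 0 r)"

lemma modulus_set_bounded:
  "bdd_above {cmod (\<sigma>' t1 - \<sigma>' t2) |t1 t2. t1 \<in> sphere 0 1 \<and> t2 \<in> sphere 0 1 \<and> cmod (t1 - t2) \<le> r}"
proof (rule bdd_aboveI)
  fix x assume "x \<in> {cmod (\<sigma>' t1 - \<sigma>' t2) |t1 t2. t1 \<in> sphere 0 1 \<and> t2 \<in> sphere 0 1 \<and> cmod (t1 - t2) \<le> r}"
  then obtain t1 t2 where "x = cmod (\<sigma>' t1 - \<sigma>' t2)" "norm t1 = 1" "norm t2 = 1" by auto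
  then show "x \<le> 2 * B"
    using norm_triangle_ineq4[of "\<sigma>' t1" "\<sigma>' t2"] norm_le_B[of t1] norm_le_B[of t2] by simp
qed

lemma le_w:
  assumes "norm T = 1" "norm S = 1" "norm (T - S) \<le> r"
  shows "norm (\<sigma>' T - \<sigma>' S) \<le> w r"
  unfolding w_def circle_modulus_def
proof (rule cSup_upper[OF _ modulus_set_bounded])
  show "norm (\<sigma>' T - \<sigma>' S) \<in> {cmod (\<sigma>' t1 - \<sigma>' t2) |t1 t2.
      t1 \<in> sphere 0 1 \<and> t2 \<in> sphere 0 1 \<and> cmod (t1 - t2) \<le> max 0 r}"
    using assms by (intro CollectI exI[of _ T] exI[of _ S]) simp
qed

lemma w_le:
  assumes "\<And>T S. norm T = 1 \<Longrightarrow> norm S = 1 \<Longrightarrow> norm (T - S) \<le> max 0 r \<Longrightarrow> norm (\<sigma>' T - \<sigma>' S) \<le> C"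
  shows "w r \<le> C"
  unfolding w_def circle_modulus_def
proof (rule cSup_least)
  show "{cmod (\<sigma>' t1 - \<sigma>' t2) |t1 t2. t1 \<in> sphere 0 1 \<and> t2 \<in> sphere 0 1 \<and> cmod (t1 - t2) \<le> max 0 r} \<noteq> {}"
    by (auto intro!: exI[of _ 1])
qed (use assms in auto)

lemma w_mono: "mono w"
proof (rule monoI, rule w_le)
  fix x y :: real and T S :: complex assume "x \<le> y" "norm T = 1" "norm S = 1" "norm (T - S) \<le> max 0 x"
  then show "norm (\<sigma>' T - \<sigma>' S) \<le> w y"
    using le_w[of T S "max 0 y"] max.mono[OF order_refl[of 0] \<open>x \<le> y\<close>] by (simp add: w_def)
qed

lemma w_nonneg: "0 \<le> w r"
  using le_w[of 1 1 "max 0 r"] by (simp add: w_def)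

lemma w_le_B: "w r \<le> 2 * B"
proof (rule w_le)
  fix T S :: complex assume "norm T = 1" "norm S = 1"
  then show "norm (\<sigma>' T - \<sigma>' S) \<le> 2 * B"
    using norm_triangle_ineq4[of "\<sigma>' T" "\<sigma>' S"] norm_le_B[of T] norm_le_B[of S] by simp
qed

lemma measurable_w [measurable]: "w \<in> borel_measurable borel"
  using w_mono by (rule borel_measurable_mono)

section \<open>The boundary curve in the angular variable\<close>

definition f :: "real \<Rightarrow> complex"
  where "f a = \<sigma> (- cis (2 * a))"

definition f' :: "real \<Rightarrow> complex"
  where "f' a = (- 2 * \<i> * cis (2 * a)) * \<sigma>' (- cis (2 * a))"

text \<open>This is the bound in \<open>f'_modulus\<close> divided by the increment: the first term
  comes from the contour derivative, whose argument moves with speed 2, and \<open>4 * B\<close>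
  from the rotating factor.\<close>

definition h :: "real \<Rightarrow> real"
  where "h x = 2 * w (2 * \<bar>x\<bar>) / \<bar>x\<bar> + 4 * B"

lemma f_deriv: "(f has_vector_derivative f' a) (at a)"
proof -
  have "((\<lambda>a. - cis (2 * a)) has_vector_derivative (- 2 * \<i> * cis (2 * a))) (at a)"
  proof -
    have "((\<lambda>z. - exp (\<i> * (2 * z))) has_field_derivative - 2 * \<i> * exp (\<i> * (2 * of_real a))) (at (of_real a))"
      by (auto intro!: derivative_eq_intros)
    from has_vector_derivative_real_field[OF this] show ?thesis by (simp add: cis_conv_exp)
  qed
  moreover have "(\<sigma> has_field_derivative \<sigma>' (- cis (2 * a))) (at (- cis (2 * a)) within sphere 0 1)"
    unfolding has_field_derivative_iff
    by (rule bspec[OF contour[unfolded contour_derivative_def]]) simp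
  then have "(\<sigma> has_field_derivative \<sigma>' (- cis (2 * a))) (at (- cis (2 * a)) within (\<lambda>a. - cis (2 * a)) ` UNIV)"
    by (rule has_field_derivative_subset) auto
  ultimately have "(\<sigma> \<circ> (\<lambda>a. - cis (2 * a)) has_vector_derivative f' a) (at a)"
    unfolding f'_def by (rule field_vector_diff_chain_within)
  then show ?thesis by (simp add: f_def[abs_def] o_def)
qed

lemma f'_modulus: "norm (f' (a + y) - f' a) \<le> 2 * w (2 * \<bar>y\<bar>) + 4 * B * \<bar>y\<bar>"
proof -
  define P Q where "P = - cis (2 * (a + y))" and "Q = - cis (2 * a)"
  have PQ: "norm P = 1" "norm Q = 1" by (simp_all add: P_def Q_def)
  have d: "norm (P - Q) \<le> 2 * \<bar>y\<bar>"
    using norm_cis_diff_le[of "2 * a" "2 * (a + y)"] by (simp add: P_def Q_def abs_mult)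
  \<comment> \<open>As \<open>f'\<close> at the parameter of Q is
    \<open>2 * \<i> * Q * \<sigma>' Q\<close>, the increment splits by the product rule.\<close>
  have "f' (a + y) - f' a = 2 * \<i> * (P * (\<sigma>' P - \<sigma>' Q) + (P - Q) * \<sigma>' Q)"
    by (simp add: f'_def P_def Q_def algebra_simps)
  also have "norm \<dots> = 2 * norm (P * (\<sigma>' P - \<sigma>' Q) + (P - Q) * \<sigma>' Q)"
    by (simp add: norm_mult)
  also have "\<dots> \<le> 2 * (norm P * norm (\<sigma>' P - \<sigma>' Q) + norm (P - Q) * norm (\<sigma>' Q))"
    by (intro mult_left_mono order_trans[OF norm_triangle_ineq]) (auto simp: norm_mult)
  also have "\<dots> \<le> 2 * (1 * w (2 * \<bar>y\<bar>) + (2 * \<bar>y\<bar>) * B)"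
    using PQ d le_w[OF PQ d] norm_le_B[OF PQ(2)] B_nonneg by (intro mult_left_mono add_mono mult_mono) auto
  finally show ?thesis by (simp add: algebra_simps)
qed

lemma h_measurable [measurable]: "h \<in> borel_measurable borel"
  unfolding h_def by measurable

text \<open>Rescaling by 2 or -2 turns the singular term into w y / y on (0, 4], as 2|x| is at most
  pi < 4. Below 1 this is the Dini integral; from 1 to 4 the integrand is at most
  \<open>2 * B\<close>.\<close>

lemma h_integrable: "(\<integral>\<^sup>+x\<in>{-pi/2..pi/2}. ennreal (h x) \<partial>lborel) < \<infinity>"
proof -
  define \<phi> where "\<phi> y = ennreal (w y / y) * indicator {0<..4} y" for y
  have [measurable]: "\<phi> \<in> borel_measurable borel" unfolding \<phi>_def by measurable
  have "(\<integral>\<^sup>+y. \<phi> y \<partial>lborel) \<le> (\<integral>\<^sup>+y. ennreal (circle_modulus \<sigma>' y / y) * indicator {0<..<1} y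
      + ennreal (2 * B) * indicator {1..4} y \<partial>lborel)"
  proof (rule nn_integral_mono)
    fix y :: real
    consider "y \<notin> {0<..4}" | "y \<in> {0<..<1}" | "y \<in> {1..4}" by fastforce
    then show "\<phi> y \<le> ennreal (circle_modulus \<sigma>' y / y) * indicator {0<..<1} y + ennreal (2 * B) * indicator {1..4} y"
    proof cases
      case 3
      then have "w y / y \<le> 2 * B / 1"
        using w_le_B[of y] w_nonneg[of y] B_nonneg by (intro frac_le) auto
      with 3 show ?thesis by (simp add: \<phi>_def ennreal_leI)
    qed (auto simp: \<phi>_def w_def)
  qed
  also have "\<dots> = (\<integral>\<^sup>+ \<eta>\<in>{0<..<1}. ennreal (circle_modulus \<sigma>' \<eta> / \<eta>) \<partial>lborel) + ennreal (2 * B) * emeasure lborel {1..4::real}"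
  proof -
    \<comment> \<open>Measurability is available for the monotone function w, which agrees with the
      modulus at positive arguments.\<close>
    have "(\<lambda>y. ennreal (circle_modulus \<sigma>' y / y) * indicator {0<..<1} y) = (\<lambda>y. ennreal (w y / y) * indicator {0<..<1} y)"
      by (auto simp: w_def fun_eq_iff split: split_indicator)
    then show ?thesis by (simp add: nn_integral_add nn_integral_cmult)
  qed
  also have "\<dots> < \<infinity>"
    using dini by (simp add: ennreal_mult_less_top)
  finally have \<phi>: "(\<integral>\<^sup>+y. \<phi> y \<partial>lborel) < \<infinity>" .
  have scaled: "(\<integral>\<^sup>+x. \<phi> (c * x) \<partial>lborel) < \<infinity>" if "c \<noteq> 0" for c
    using \<phi> that nn_integral_real_affine[of \<phi> c 0] by (auto simp: ennreal_mult_less_top)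
  have "(\<integral>\<^sup>+x\<in>{-pi/2..pi/2}. ennreal (h x) \<partial>lborel)
      \<le> (\<integral>\<^sup>+x. ennreal 4 * (\<phi> (2 * x) + \<phi> (- 2 * x)) + ennreal (4 * B) * indicator {-pi/2..pi/2} x \<partial>lborel)"
  proof (rule nn_integral_mono)
    fix x :: real
    have "ennreal (2 * w (2 * \<bar>x\<bar>) / \<bar>x\<bar>) \<le> ennreal 4 * (\<phi> (2 * x) + \<phi> (- 2 * x))" if "x \<in> {-pi/2..pi/2}"
    proof (cases "x = 0")
      case False
      have "2 * \<bar>x\<bar> \<in> {0<..4}" using that False pi_less_4 by (auto simp: abs_if)
      \<comment> \<open>The 4 arises because w is to be divided by 2|x| instead of |x|.\<close>
      then have "ennreal (2 * w (2 * \<bar>x\<bar>) / \<bar>x\<bar>) = ennreal 4 * \<phi> (2 * \<bar>x\<bar>)"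
        using w_nonneg by (simp add: \<phi>_def ennreal_mult[symmetric] del: ennreal_numeral)
      also have "\<dots> \<le> ennreal 4 * (\<phi> (2 * x) + \<phi> (- 2 * x))"
        by (intro mult_left_mono) (auto simp: abs_if add_increasing add_increasing2)
      finally show ?thesis .
    qed simp
    moreover have "ennreal (h x) = ennreal (2 * w (2 * \<bar>x\<bar>) / \<bar>x\<bar>) + ennreal (4 * B)"
      unfolding h_def using w_nonneg B_nonneg by (intro ennreal_plus) auto
    ultimately show "ennreal (h x) * indicator {-pi/2..pi/2} x
        \<le> ennreal 4 * (\<phi> (2 * x) + \<phi> (- 2 * x)) + ennreal (4 * B) * indicator {-pi/2..pi/2} x"
      by (auto split: split_indicator intro: add_mono)
  qed
  also have "\<dots> = ennreal 4 * ((\<integral>\<^sup>+x. \<phi> (2 * x) \<partial>lborel) + (\<integral>\<^sup>+x. \<phi> (- 2 * x) \<partial>lborel))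
      + ennreal (4 * B) * emeasure lborel {-pi/2..pi/2}"
    by (simp add: nn_integral_add nn_integral_cmult del: ennreal_numeral)
  also have "\<dots> < \<infinity>"
    using scaled[of 2] scaled[of "-2"] by (simp add: ennreal_mult_less_top)
  finally show ?thesis .
qed

sublocale curve: dini_curve f f' h
proof
  fix a b x y :: real
  show "(f has_vector_derivative f' a) (at a)" by (rule f_deriv)
  show "continuous_on UNIV f'"
    unfolding f'_def by (intro continuous_intros continuous_on_compose2[OF continuous]) auto
  show "f' a \<noteq> 0"
    using nonzero[of "- cis (2 * a)"] by (simp add: f'_def)
  have "cis (2 * (a + pi)) = cis (2 * a)"
    by (simp add: distrib_left cis_mult[symmetric])
  then show "f (a + pi) = f a" "f' (a + pi) = f' a"
    by (simp_all only: f_def f'_def)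
  \<comment> \<open>The parameter runs once round the circle while it increases by pi.\<close>
  show "sin (a - b) = 0" if "f a = f b"
  proof -
    have "cis (2 * a) = cis (2 * b)"
      using inj_onD[OF inj_circle, of "- cis (2 * a)" "- cis (2 * b)"] that by (simp add: f_def)
    then have "cis (2 * (a - b)) = 1"
      by (simp add: right_diff_distrib cis_divide[symmetric])
    then have "cos (2 * (a - b)) = 1"
      by (simp add: complex_eq_iff)
    then show ?thesis
      using cos_double_sin[of "a - b"] by simp
  qed
  show "norm (f' (a + y) - f' a) \<le> \<bar>x\<bar> * h x" if "\<bar>y\<bar> \<le> \<bar>x\<bar>"
  proof (cases "x = 0")
    case False
    have "norm (f' (a + y) - f' a) \<le> 2 * w (2 * \<bar>y\<bar>) + 4 * B * \<bar>y\<bar>" by (rule f'_modulus)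
    also have "\<dots> \<le> 2 * w (2 * \<bar>x\<bar>) + 4 * B * \<bar>x\<bar>"
      using that B_nonneg by (intro add_mono mult_left_mono monoD[OF w_mono]) auto
    also have "\<dots> = \<bar>x\<bar> * h x"
      using False by (simp add: h_def field_simps)
    finally show ?thesis .
  qed (use that in simp)
  show "0 \<le> h x"
    using w_nonneg B_nonneg by (simp add: h_def)
  show "h \<in> borel_measurable borel" by (rule h_measurable)
  show "(\<integral>\<^sup>+x\<in>{-pi/2..pi/2}. ennreal (h x) \<partial>lborel) < \<infinity>" by (rule h_integrable)
qed

section \<open>The given kernel in terms of the angular one\<close>

lemma tau_eq: "tau \<sigma> t = f (arctan t)"
  by (simp only: tau_def f_def cis_double_arctan)

lemma tau_deriv: "(tau \<sigma> has_vector_derivative (1 / (1 + s\<^sup>2)) *\<^sub>R f' (arctan s)) (at s)"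
proof -
  have "(arctan has_vector_derivative 1 / (1 + s\<^sup>2)) (at s)"
    using DERIV_arctan[of s] by (simp add: has_real_derivative_iff_has_vector_derivative inverse_eq_divide)
  from vector_diff_chain_at[OF this f_deriv] show ?thesis
    by (simp add: o_def tau_eq[abs_def])
qed

lemma dtau: "dtau \<sigma> s = (1 / (1 + s\<^sup>2)) *\<^sub>R f' (arctan s)"
  by (rule vector_derivative_at[OF tau_deriv])

lemma dtau2: "dtau2 \<sigma> s = Im (dtau \<sigma> s)"
proof -
  have "((\<lambda>s. Im (tau \<sigma> s)) has_vector_derivative Im (dtau \<sigma> s)) (at s)"
    unfolding dtau by (rule bounded_linear.has_vector_derivative[OF bounded_linear_Im tau_deriv])
  then show ?thesis
    by (intro DERIV_imp_deriv) (simp add: has_real_derivative_iff_has_vector_derivative tau2_def[abs_def])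
qed

lemma k1_eq: "k1 \<sigma> t s = (1 / (1 + s\<^sup>2)) *\<^sub>R curve.K1 (arctan t) (arctan s)"
proof -
  have "(1 + s * t) / ((s - t) * (s\<^sup>2 + 1)) = (1 / (1 + s\<^sup>2)) * cot (arctan s - arctan t)"
    by (simp add: cot_arctan_diff add.commute)
  then show ?thesis
    by (simp add: k1_def curve.K1_def dtau tau_eq scaleR_conv_of_real diff_divide_distrib ac_simps del: of_real_add of_real_power)
qed

text \<open>Over the common denominator, the numerator F Im \<Delta> - \<Delta> Im F is the real
  number -Im (F cnj \<Delta>), which is recognized as a multiple of Im (F / \<Delta>).\<close>

lemma k2_eq: "k2 \<sigma> t s = (1 / (1 + s\<^sup>2)) *\<^sub>R curve.K2 (arctan t) (arctan s)"
proof -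
  define F \<Delta> r where "F = f' (arctan s)" and "\<Delta> = f (arctan s) - f (arctan t)" and "r = 1 / (1 + s\<^sup>2)"
  define q where "q = Im (F * cnj \<Delta>)"
  have num: "F * of_real (Im \<Delta>) - of_real (Im F) * \<Delta> = - of_real q"
    by (simp add: q_def complex_eq_iff algebra_simps)
  have "k2 \<sigma> t s = (r *\<^sub>R F) * of_real (Im \<Delta>) / (2 * \<Delta>\<^sup>2) - of_real (Im (r *\<^sub>R F)) / (2 * \<Delta>)"
    unfolding k2_def dtau2 dtau by (simp add: tau2_def tau_eq F_def \<Delta>_def r_def)
  also have "\<dots> = of_real r * ((F * of_real (Im \<Delta>) - of_real (Im F) * \<Delta>) / (2 * \<Delta>\<^sup>2))"
    by (cases "\<Delta> = 0") (simp_all add: scaleR_conv_of_real field_simps power2_eq_square)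
  also have "\<dots> = of_real r * (- of_real (Im (F / \<Delta>)) * cnj \<Delta> / (2 * \<Delta>))"
  proof (cases "\<Delta> = 0")
    case False
    have "Im (F / \<Delta>) = q / (norm \<Delta>)\<^sup>2"
      by (simp add: q_def complex_div_cnj[of F \<Delta>] Im_divide_of_real flip: of_real_power)
    then have "of_real (Im (F / \<Delta>)) = of_real q / (\<Delta> * cnj \<Delta>)"
      by (simp only: of_real_divide complex_norm_square)
    with False show ?thesis
      unfolding num by (simp add: power2_eq_square)
  qed simp
  \<comment> \<open>The cotangent in K1 is real and does not change the imaginary part.\<close>
  also have "Im (F / \<Delta>) = Im (curve.K1 (arctan t) (arctan s))"
    by (simp add: curve.K1_def F_def \<Delta>_def)
  finally show ?thesis
    by (simp add: curve.K2_def \<Delta>_def r_def scaleR_conv_of_real)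
qed

lemma biharm_kernel_eq: "biharm_kernel \<sigma> t s = curve.\<kappa> (arctan t) s"
  unfolding biharm_kernel_def curve.\<kappa>_def curve.K_def k1_eq k2_eq scaleR_add_right scaleR_scaleC mult_scaleR_right ..

end

text \<open>The first three conjuncts certify that the last one is meaningful: the integral is not
  the default 0 of a nonintegrable function, \<open>Lim\<close> denotes a true limit, and
  \<open>Bcontfun\<close> is applied to a continuous function.\<close>

theorem theorem6p13:
  fixes D :: "(real \<times> real) set" and \<sigma> \<sigma>' :: "complex \<Rightarrow> complex"
  assumes "open D" "connected D" "D \<noteq> {}" "bounded D"
    and "smooth_jordan_curve (frontier D)"
    and "conformal_disk_map \<sigma> (complex_region D)"
    and "contour_derivative \<sigma> \<sigma>'"
    and "continuous_on (sphere 0 1) \<sigma>'"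
    and "\<forall>T\<in>sphere 0 1. \<sigma>' T \<noteq> 0"
    and "(\<integral>\<^sup>+ \<eta>\<in>{0<..<1}. ennreal (circle_modulus \<sigma>' \<eta> / \<eta>) \<partial>lborel) < \<infinity>"
  shows "(\<forall>(g :: rbar \<Rightarrow>\<^sub>C biharm) t. integrable lborel (\<lambda>s. apply_bcontfun g (Fin s) * biharm_kernel \<sigma> t s)) \<and>
    (\<forall>g :: rbar \<Rightarrow>\<^sub>C biharm. \<exists>L. (integral_op_real \<sigma> (apply_bcontfun g) \<longlongrightarrow> L) at_infinity) \<and>
    (\<forall>g :: rbar \<Rightarrow>\<^sub>C biharm. integral_op \<sigma> (apply_bcontfun g) \<in> bcontfun) \<and>
    compact_operator (\<lambda>g :: rbar \<Rightarrow>\<^sub>C biharm. Bcontfun (integral_op \<sigma> (apply_bcontfun g)))"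
proof -
  from assms(6) obtain \<sigma>inv where "homeomorphism (cball 0 1) (closure (complex_region D)) \<sigma> \<sigma>inv"
    by (auto simp: conformal_disk_map_def)
  then have "inj_on \<sigma> (cball 0 1)"
    by (metis homeomorphism_def inj_on_inverseI)
  then have "inj_on \<sigma> (sphere 0 1)"
    by (rule inj_on_subset) auto
  then interpret dini_circle_map \<sigma> \<sigma>'
    using assms(7-) by unfold_locales auto
  obtain M where "L1_kernel curve.\<kappa> M" using curve.L1_kernel by blast
  then interpret op: L1_kernel curve.\<kappa> M .
  have mem: "arctan t \<in> {-pi/2..pi/2}" for t
    using arctan_bounded[of t] by simp
  have real: "integral_op_real \<sigma> (apply_bcontfun g) t = op.U g (arctan t)" for g t
    by (simp add: integral_op_real_def op.U_def biharm_kernel_eq)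
  \<comment> \<open>Identifying the limit with the end value of U is what makes
    \<open>integral_op\<close> agree with V at \<open>Infty\<close>.\<close>
  have lim: "(integral_op_real \<sigma> (apply_bcontfun g) \<longlongrightarrow> op.U g (pi/2)) at_infinity" for g
    unfolding real[abs_def] by (rule op.tendsto_U)
  have op: "integral_op \<sigma> (apply_bcontfun g) = op.V g" for g
  proof
    show "integral_op \<sigma> (apply_bcontfun g) x = op.V g x" for x
      by (cases x) (simp_all add: real op.V_def tendsto_Lim[OF trivial_limit_at_infinity lim])
  qed
  show ?thesis
    using lim op.V_bcontfun op.compact_operator_V op.integrable_mult(1)[OF op.integrable_kernel[OF mem]]
    by (auto simp: op biharm_kernel_eq)
qed

end
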